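(* Let $\Bbbk$ be a principal ideal domain. Let $f:C\xrightarrow{\simeq}D$ be a quasi-isomorphism of differential graded coalgebras over $\Bbbk$, where $C$ and $D$ are $\Bbbk$-free. Let $\tilde c\in C$ and $\tilde d\in D$ be cycles such that $[\tilde d]=H_*(f)([\tilde c])$. Then the morphism of right $C^\vee$-modules $\tilde c\cap-:C^\vee\to C$, $a\mapsto\tilde c\cap a$, is a quasi-isomorphism if and only if the morphism of right $D^\vee$-modules $\tilde d\cap-:D^\vee\to D$, $a\mapsto\tilde d\cap a$, is a quasi-isomorphism.
   Context: $C^\vee=\mathrm{Hom}(C,\Bbbk)$ is the dual differential graded algebra of a differential graded coalgebra $C$. The cap product associated to $C$ is the composite $$\cap:C\otimes C^\vee\xrightarrow{\Delta\otimes C^\vee}C\otimes C\otimes C^\vee\xrightarrow{C\otimes\tau}C\otimes C^\vee\otimes C\xrightarrow{ev\otimes C}\Bbbk\otimes C\cong C,$$ where $\Delta$ is the diagonal of $C$, $\tau(n\otimes\varphi)=(-1)^{|n||\varphi|}\varphi\otimes n$ and $ev(c\otimes\varphi)=(-1)^{|\varphi||c|}\varphi(c)$; it makes $C$ a right $C^\vee$-module. *)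

theory Defs
  imports HOL.Modules "HOL-Library.Poly_Mapping" "HOL-Library.Function_Algebras"
begin

class principal_ideal_domain = idom +
  assumes principal_ideal:
    "\<lbrakk>0 \<in> I; \<And>x y. x \<in> I \<Longrightarrow> y \<in> I \<Longrightarrow> x + y \<in> I; \<And>r x. x \<in> I \<Longrightarrow> r * x \<in> I\<rbrakk>
      \<Longrightarrow> \<exists>a. I = range (\<lambda>r. r * a)"

text \<open>
  A differential graded module is a family of submodules of an ambient module whose sum is
  direct; its underlying module is that sum (\<open>total\<close> below). Degrees are lower degrees indexed
  by all integers, and differentials have degree \<open>-1\<close>.
\<close>

record ('k, 'a) dg_module =
  scale :: "'k \<Rightarrow> 'a \<Rightarrow> 'a"
  grade :: "int \<Rightarrow> 'a set"
  diff :: "'a \<Rightarrow> 'a"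

definition total :: "('k::comm_ring_1, 'a::ab_group_add, 'z) dg_module_scheme \<Rightarrow> 'a set" where
  "total M = module.span (scale M) (\<Union>n. grade M n)"

definition k_linear_on ::
  "'a set \<Rightarrow> ('k \<Rightarrow> 'a \<Rightarrow> 'a) \<Rightarrow> ('k \<Rightarrow> 'b \<Rightarrow> 'b) \<Rightarrow> ('a::ab_group_add \<Rightarrow> 'b::ab_group_add) \<Rightarrow> bool"
  where
  "k_linear_on V s t g \<longleftrightarrow>
    (\<forall>x\<in>V. \<forall>y\<in>V. g (x + y) = g x + g y) \<and> (\<forall>r. \<forall>x\<in>V. g (s r x) = t r (g x))"

definition direct_family :: "(int \<Rightarrow> 'a::ab_group_add set) \<Rightarrow> bool" where
  "direct_family G \<longleftrightarrow>
    (\<forall>f. finite {n. f n \<noteq> 0} \<and> (\<forall>n. f n \<in> G n) \<and> (\<Sum>n | f n \<noteq> 0. f n) = 0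
      \<longrightarrow> (\<forall>n. f n = 0))"

definition is_dg_module :: "('k::comm_ring_1, 'a::ab_group_add, 'z) dg_module_scheme \<Rightarrow> bool" where
  "is_dg_module M \<longleftrightarrow>
    module (scale M) \<and>
    (\<forall>n. module.subspace (scale M) (grade M n)) \<and>
    direct_family (grade M) \<and>
    k_linear_on (total M) (scale M) (scale M) (diff M) \<and>
    (\<forall>n. diff M ` grade M n \<subseteq> grade M (n - 1)) \<and>
    (\<forall>x\<in>total M. diff M (diff M x) = 0)"

definition k_free :: "('k::comm_ring_1, 'a::ab_group_add, 'z) dg_module_scheme \<Rightarrow> bool" where
  "k_free M \<longleftrightarrow>
    (\<exists>B. \<not> module.dependent (scale M) B \<and> module.span (scale M) B = total M)"


subsection \<open>Homology and quasi-isomorphisms\<close>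

definition cycles :: "('k, 'a::ab_group_add, 'z) dg_module_scheme \<Rightarrow> int \<Rightarrow> 'a set" where
  "cycles M n = {x \<in> grade M n. diff M x = 0}"

definition boundaries :: "('k, 'a, 'z) dg_module_scheme \<Rightarrow> int \<Rightarrow> 'a set" where
  "boundaries M n = diff M ` grade M (n + 1)"

definition homologous :: "('k, 'a::ab_group_add, 'z) dg_module_scheme \<Rightarrow> int \<Rightarrow> ('a \<times> 'a) set" where
  "homologous M n =
    {(x, y). x \<in> cycles M n \<and> y \<in> cycles M n \<and> x - y \<in> boundaries M n}"

definition homology :: "('k, 'a::ab_group_add, 'z) dg_module_scheme \<Rightarrow> int \<Rightarrow> 'a set set" where
  "homology M n = cycles M n // homologous M n"

definition homology_class ::
  "('k, 'a::ab_group_add, 'z) dg_module_scheme \<Rightarrow> int \<Rightarrow> 'a \<Rightarrow> 'a set" where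
  "homology_class M n x = homologous M n `` {x}"

text \<open>The map induced on homology by \<open>g\<close>, with values in degree \<open>m\<close> of the target:\<close>

definition homology_map ::
  "('l, 'b::ab_group_add, 'z) dg_module_scheme \<Rightarrow> int \<Rightarrow> ('a \<Rightarrow> 'b) \<Rightarrow> 'a set \<Rightarrow> 'b set" where
  "homology_map N m g X = (\<Union>x\<in>X. homology_class N m (g x))"

definition sgn_pow :: "int \<Rightarrow> 'k::comm_ring_1" where
  "sgn_pow n = (if even n then 1 else -1)"

definition dg_map ::
  "int \<Rightarrow> ('k::comm_ring_1, 'a::ab_group_add, 'y) dg_module_scheme
    \<Rightarrow> ('k, 'b::ab_group_add, 'z) dg_module_scheme \<Rightarrow> ('a \<Rightarrow> 'b) \<Rightarrow> bool" where
  "dg_map n M N g \<longleftrightarrow>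
    k_linear_on (total M) (scale M) (scale N) g \<and>
    (\<forall>m. g ` grade M m \<subseteq> grade N (m + n)) \<and>
    (\<forall>x\<in>total M. diff N (g x) = scale N (sgn_pow n) (g (diff M x)))"

definition quasi_iso ::
  "int \<Rightarrow> ('k::comm_ring_1, 'a::ab_group_add, 'y) dg_module_scheme
    \<Rightarrow> ('k, 'b::ab_group_add, 'z) dg_module_scheme \<Rightarrow> ('a \<Rightarrow> 'b) \<Rightarrow> bool" where
  "quasi_iso n M N g \<longleftrightarrow>
    dg_map n M N g \<and>
    (\<forall>m. bij_betw (homology_map N (m + n) g) (homology M m) (homology N (m + n)))"


subsection \<open>Tensor products\<close>

text \<open>
  Tensor products of modules are quotients of the free module on tuples by the multilinearity
  relations; an element of the tensor product is a coset of \<open>tensor_rel\<close>.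
\<close>

definition fscale :: "'k::comm_ring_1 \<Rightarrow> ('a \<Rightarrow>\<^sub>0 'k) \<Rightarrow> ('a \<Rightarrow>\<^sub>0 'k)" where
  "fscale r p = Poly_Mapping.map (\<lambda>a. r * a) p"

definition gen :: "'a \<Rightarrow> ('a \<Rightarrow>\<^sub>0 'k::comm_ring_1)" where
  "gen x = Poly_Mapping.single x 1"

definition lin_ext ::
  "('k::comm_ring_1 \<Rightarrow> 'b \<Rightarrow> 'b) \<Rightarrow> ('a \<Rightarrow> 'b::ab_group_add) \<Rightarrow> ('a \<Rightarrow>\<^sub>0 'k) \<Rightarrow> 'b" where
  "lin_ext s g p = (\<Sum>x\<in>Poly_Mapping.keys p. s (Poly_Mapping.lookup p x) (g x))"

definition tensor_rel ::
  "('k::comm_ring_1 \<Rightarrow> 'a::ab_group_add \<Rightarrow> 'a) \<Rightarrow> ('k \<Rightarrow> 'b::ab_group_add \<Rightarrow> 'b)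
    \<Rightarrow> ('a \<times> 'b \<Rightarrow>\<^sub>0 'k) set" where
  "tensor_rel s t = module.span fscale
    ({gen (x + x', y) - gen (x, y) - gen (x', y) | x x' y. True} \<union>
     {gen (x, y + y') - gen (x, y) - gen (x, y') | x y y'. True} \<union>
     {gen (s r x, y) - fscale r (gen (x, y)) | r x y. True} \<union>
     {gen (x, t r y) - fscale r (gen (x, y)) | r x y. True})"

definition tensor_class ::
  "('k::comm_ring_1 \<Rightarrow> 'a::ab_group_add \<Rightarrow> 'a) \<Rightarrow> ('k \<Rightarrow> 'b::ab_group_add \<Rightarrow> 'b)
    \<Rightarrow> ('a \<times> 'b \<Rightarrow>\<^sub>0 'k) \<Rightarrow> ('a \<times> 'b \<Rightarrow>\<^sub>0 'k) set" where
  "tensor_class s t p = {q. q - p \<in> tensor_rel s t}"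

definition tensor ::
  "('k::comm_ring_1 \<Rightarrow> 'a::ab_group_add \<Rightarrow> 'a) \<Rightarrow> ('k \<Rightarrow> 'b::ab_group_add \<Rightarrow> 'b)
    \<Rightarrow> ('a \<times> 'b \<Rightarrow>\<^sub>0 'k) set set" where
  "tensor s t = range (tensor_class s t)"

definition tensor3_rel ::
  "('k::comm_ring_1 \<Rightarrow> 'a::ab_group_add \<Rightarrow> 'a) \<Rightarrow> ('a \<times> 'a \<times> 'a \<Rightarrow>\<^sub>0 'k) set" where
  "tensor3_rel s = module.span fscale
    ({gen (x + x', y, z) - gen (x, y, z) - gen (x', y, z) | x x' y z. True} \<union>
     {gen (x, y + y', z) - gen (x, y, z) - gen (x, y', z) | x y y' z. True} \<union>
     {gen (x, y, z + z') - gen (x, y, z) - gen (x, y, z') | x y z z'. True} \<union>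
     {gen (s r x, y, z) - fscale r (gen (x, y, z)) | r x y z. True} \<union>
     {gen (x, s r y, z) - fscale r (gen (x, y, z)) | r x y z. True} \<union>
     {gen (x, y, s r z) - fscale r (gen (x, y, z)) | r x y z. True})"

text \<open>The homogeneous component in degree \<open>n\<close> of an element of the direct sum of the \<open>G n\<close>:\<close>

definition component :: "(int \<Rightarrow> 'a::ab_group_add set) \<Rightarrow> int \<Rightarrow> 'a \<Rightarrow> 'a" where
  "component G n x =
    (THE f. finite {i. f i \<noteq> 0} \<and> (\<forall>i. f i \<in> G i) \<and> (\<Sum>i | f i \<noteq> 0. f i) = x) n"

definition degrees :: "(int \<Rightarrow> 'a::ab_group_add set) \<Rightarrow> 'a \<Rightarrow> int set" where
  "degrees G x = {n. component G n x \<noteq> 0}"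

text \<open>
  The graded interchange, given on homogeneous elements by
  \<open>x \<otimes> y \<mapsto> (-1)\<^bsup>|x||y|\<^esup> y \<otimes> x\<close>, as a representative in the free module on pairs:
\<close>

definition twist ::
  "(int \<Rightarrow> 'a::ab_group_add set) \<Rightarrow> (int \<Rightarrow> 'b::ab_group_add set) \<Rightarrow> 'a \<Rightarrow> 'b
    \<Rightarrow> ('b \<times> 'a \<Rightarrow>\<^sub>0 'k::comm_ring_1)" where
  "twist G H x y =
    (\<Sum>i\<in>degrees G x. \<Sum>j\<in>degrees H y.
      fscale (sgn_pow (i * j)) (gen (component H j y, component G i x)))"


subsection \<open>Differential graded coalgebras\<close>

text \<open>The value \<open>comult C c\<close> is an element of the tensor product, that is, a coset.\<close>

record (overloaded) ('k, 'a) dg_coalgebra = "('k, 'a) dg_module" +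
  comult :: "'a \<Rightarrow> ('a \<times> 'a \<Rightarrow>\<^sub>0 'k) set"
  counit :: "'a \<Rightarrow> 'k"

definition comult_rep ::
  "('k::comm_ring_1, 'a::ab_group_add, 'z) dg_coalgebra_scheme \<Rightarrow> 'a \<Rightarrow> ('a \<times> 'a \<Rightarrow>\<^sub>0 'k)" where
  "comult_rep C c = (SOME p. p \<in> comult C c)"

definition tensor_grade ::
  "('k::comm_ring_1, 'a::ab_group_add, 'z) dg_module_scheme \<Rightarrow> int \<Rightarrow> ('a \<times> 'a \<Rightarrow>\<^sub>0 'k) set" where
  "tensor_grade M n = module.span fscale
    {gen (x, y) | x y i j. x \<in> grade M i \<and> y \<in> grade M j \<and> i + j = n}"

text \<open>\<open>x \<otimes> y \<mapsto> dx \<otimes> y + (-1)\<^bsup>|x|\<^esup> x \<otimes> dy\<close>\<close>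

definition tensor_diff ::
  "('k::comm_ring_1, 'a::ab_group_add, 'z) dg_module_scheme
    \<Rightarrow> ('a \<times> 'a \<Rightarrow>\<^sub>0 'k) \<Rightarrow> ('a \<times> 'a \<Rightarrow>\<^sub>0 'k)" where
  "tensor_diff M = lin_ext fscale (\<lambda>(x, y).
     gen (diff M x, y) +
     (\<Sum>i\<in>degrees (grade M) x.
       fscale (sgn_pow i) (gen (component (grade M) i x, diff M y))))"

definition comult_left ::
  "('k::comm_ring_1, 'a::ab_group_add, 'z) dg_coalgebra_scheme
    \<Rightarrow> ('a \<times> 'a \<Rightarrow>\<^sub>0 'k) \<Rightarrow> ('a \<times> 'a \<times> 'a \<Rightarrow>\<^sub>0 'k)" where
  "comult_left C = lin_ext fscale (\<lambda>(x, y).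
     lin_ext fscale (\<lambda>(x', x''). gen (x', x'', y)) (comult_rep C x))"

definition comult_right ::
  "('k::comm_ring_1, 'a::ab_group_add, 'z) dg_coalgebra_scheme
    \<Rightarrow> ('a \<times> 'a \<Rightarrow>\<^sub>0 'k) \<Rightarrow> ('a \<times> 'a \<times> 'a \<Rightarrow>\<^sub>0 'k)" where
  "comult_right C = lin_ext fscale (\<lambda>(x, y).
     lin_ext fscale (\<lambda>(y', y''). gen (x, y', y'')) (comult_rep C y))"

text \<open>
  Taking \<open>total C = UNIV\<close> is no restriction, as the type variable ranges over all abelian
  groups. Since \<open>comult C c\<close> is a full coset of the tensor relations, identities in
  \<open>C \<otimes> C\<close> are stated as membership of representatives.
\<close>

definition is_dg_coalgebra ::
  "('k::comm_ring_1, 'a::ab_group_add, 'z) dg_coalgebra_scheme \<Rightarrow> bool" where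
  "is_dg_coalgebra C \<longleftrightarrow>
    is_dg_module C \<and> total C = UNIV \<and>
    (\<forall>c. comult C c \<in> tensor (scale C) (scale C)) \<and>
    (\<forall>c c'. \<forall>p\<in>comult C c. \<forall>p'\<in>comult C c'. p + p' \<in> comult C (c + c')) \<and>
    (\<forall>r c. \<forall>p\<in>comult C c. fscale r p \<in> comult C (scale C r c)) \<and>
    (\<forall>n. \<forall>c\<in>grade C n. \<exists>p\<in>comult C c. p \<in> tensor_grade C n) \<and>
    (\<forall>c. \<forall>p\<in>comult C c. tensor_diff C p \<in> comult C (diff C c)) \<and>
    module_hom (scale C) (*) (counit C) \<and>
    (\<forall>n. \<forall>c\<in>grade C n. n \<noteq> 0 \<longrightarrow> counit C c = 0) \<and>
    (\<forall>c. counit C (diff C c) = 0) \<and>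
    (\<forall>c. \<forall>p\<in>comult C c. comult_left C p - comult_right C p \<in> tensor3_rel (scale C)) \<and>
    (\<forall>c. \<forall>p\<in>comult C c. lin_ext (scale C) (\<lambda>(x, y). scale C (counit C x) y) p = c) \<and>
    (\<forall>c. \<forall>p\<in>comult C c. lin_ext (scale C) (\<lambda>(x, y). scale C (counit C y) x) p = c)"

definition dg_coalgebra_hom ::
  "('k::comm_ring_1, 'a::ab_group_add, 'y) dg_coalgebra_scheme
    \<Rightarrow> ('k, 'b::ab_group_add, 'z) dg_coalgebra_scheme \<Rightarrow> ('a \<Rightarrow> 'b) \<Rightarrow> bool" where
  "dg_coalgebra_hom C D f \<longleftrightarrow>
    dg_map 0 C D f \<and>
    (\<forall>c. \<forall>p\<in>comult C c. lin_ext fscale (\<lambda>(x, y). gen (f x, f y)) p \<in> comult D (f c)) \<and>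
    (\<forall>c. counit D (f c) = counit C c)"


subsection \<open>The dual algebra and the cap product\<close>

text \<open>
  The piece of degree \<open>n\<close> consists of the linear forms of degree \<open>n\<close>, where \<open>\<Bbbk>\<close> sits in degree
  \<open>0\<close>, and the differential is \<open>d\<phi> = - (-1)\<^bsup>|\<phi>|\<^esup> \<phi> \<circ> d\<close>. The dual is the direct sum of these
  pieces, which is only a part of the ambient type of functions.
\<close>

definition dual_grade ::
  "('k::comm_ring_1, 'a::ab_group_add, 'z) dg_module_scheme \<Rightarrow> int \<Rightarrow> ('a \<Rightarrow> 'k) set" where
  "dual_grade C n =
    {\<phi>. module_hom (scale C) (*) \<phi> \<and> (\<forall>i. \<forall>x\<in>grade C i. i + n \<noteq> 0 \<longrightarrow> \<phi> x = 0)}"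

definition dual ::
  "('k::comm_ring_1, 'a::ab_group_add, 'z) dg_module_scheme \<Rightarrow> ('k, 'a \<Rightarrow> 'k) dg_module" where
  "dual C =
    \<lparr>scale = (\<lambda>r \<phi> x. r * \<phi> x),
     grade = dual_grade C,
     diff = (\<lambda>\<phi> x. - (\<Sum>m\<in>degrees (dual_grade C) \<phi>.
       sgn_pow m * component (dual_grade C) m \<phi> (diff C x)))\<rparr>"

text \<open>
  The convolution product
  \<open>(\<phi> \<psi>)(c) = \<Sum> (-1)\<^bsup>|\<psi>||c'|\<^esup> \<phi>(c') \<psi>(c'')\<close> where \<open>\<Delta> c = \<Sum> c' \<otimes> c''\<close>:
\<close>

definition dual_mult ::
  "('k::comm_ring_1, 'a::ab_group_add, 'z) dg_coalgebra_scheme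
    \<Rightarrow> ('a \<Rightarrow> 'k) \<Rightarrow> ('a \<Rightarrow> 'k) \<Rightarrow> ('a \<Rightarrow> 'k)" where
  "dual_mult C \<phi> \<psi> c =
    lin_ext (*) (\<lambda>(x, y).
      lin_ext (*) (\<lambda>(\<psi>', x'). \<phi> x' * \<psi>' y) (twist (grade C) (grade (dual C)) x \<psi>))
    (comult_rep C c)"

text \<open>\<open>ev (c \<otimes> \<phi>) = (-1)\<^bsup>|\<phi>||c|\<^esup> \<phi>(c)\<close>\<close>

definition ev ::
  "('k::comm_ring_1, 'a::ab_group_add, 'z) dg_module_scheme \<Rightarrow> 'a \<Rightarrow> ('a \<Rightarrow> 'k) \<Rightarrow> 'k" where
  "ev C c \<phi> = lin_ext (*) (\<lambda>(\<psi>, x). \<psi> x) (twist (grade C) (grade (dual C)) c \<phi>)"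

text \<open>
  The cap product is the composite
  \<open>c \<otimes> \<phi> \<mapsto> \<Sum> x \<otimes> y \<otimes> \<phi> \<mapsto> \<Sum> x \<otimes> \<tau>(y \<otimes> \<phi>) \<mapsto> \<Sum> ev (x \<otimes> \<psi>) z\<close>,
  where \<open>\<Delta> c = \<Sum> x \<otimes> y\<close> and \<open>\<tau>(y \<otimes> \<phi>) = \<Sum> \<psi> \<otimes> z\<close>.
\<close>

definition cap ::
  "('k::comm_ring_1, 'a::ab_group_add, 'z) dg_coalgebra_scheme \<Rightarrow> 'a \<Rightarrow> ('a \<Rightarrow> 'k) \<Rightarrow> 'a" where
  "cap C c \<phi> =
    lin_ext (scale C) (\<lambda>(x, y).
      lin_ext (scale C) (\<lambda>(\<psi>, z). scale C (ev C x \<psi>) z)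
        (twist (grade C) (grade (dual C)) y \<phi>))
    (comult_rep C c)"

text \<open>Morphisms of degree \<open>n\<close> of right modules over the dual algebra, from that algebra to \<open>C\<close>:\<close>

definition dual_module_hom ::
  "int \<Rightarrow> ('k::comm_ring_1, 'a::ab_group_add, 'z) dg_coalgebra_scheme
    \<Rightarrow> (('a \<Rightarrow> 'k) \<Rightarrow> 'a) \<Rightarrow> bool" where
  "dual_module_hom n C g \<longleftrightarrow>
    dg_map n (dual C) C g \<and>
    (\<forall>\<phi>\<in>total (dual C). \<forall>\<psi>\<in>total (dual C). g (dual_mult C \<phi> \<psi>) = cap C (g \<phi>) \<psi>)"

end

theory Submission
  imports Defs "HOL-Library.Product_Plus"
begin

text \<open>
  For \<open>c\<close> of degree \<open>n\<close> and \<open>\<phi>\<close> of degree \<open>m\<close> the signs in the cap product collect to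
  \<open>c \<inter> \<phi> = (-1)\<^bsup>nm\<^esup> \<Sum> \<phi>(c') c''\<close>. This gives the Leibniz rule, the module law (from
  coassociativity), and the naturality \<open>f (c \<inter> (\<beta> \<circ> f)) = f c \<inter> \<beta>\<close>. As \<open>d\<close> is homologous
  to \<open>f c\<close>, on homology \<open>d \<inter> -\<close> is the composite of the dual of \<open>f\<close>, of \<open>c \<inter> -\<close> and of \<open>f\<close>,
  so the claim is two-out-of-three once the dual of \<open>f\<close> is known to be a quasi-isomorphism.
  For the latter, the mapping cone of \<open>f\<close> is acyclic and free over a principal ideal domain, so
  its boundaries are projective and every cocycle on the cone is a coboundary.
\<close>

subsection \<open>Submodules of free modules over a principal ideal domain\<close>

text \<open>Dualizing reverses \<open>f\<close>, so one side of the square is \<open>cap D d\<close>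
  and the other is pullback of forms along \<open>f\<close>, then \<open>cap C c\<close>, then
  \<open>f\<close>; no inverse of \<open>f\<close> is formed, and all comparisons are made with
  cycles modulo boundaries. The delicate leg is the pullback. Over a general ring an acyclic complex
  of free modules that is unbounded in both directions need not be contractible; the hypothesis on
  the ring enters exactly in the splitting below. Freeness is given for the whole module, not degree
  by degree, so the splitting concerns arbitrary submodules of a module with coordinates, and the
  cone is used one degree at a time. A form on the cone is a pair of forms on \<open>C\<close> and
  \<open>D\<close>. A cocycle pair records why the pullback of a cocycle of \<open>D\<close> is a
  coboundary, and (\<alpha>, 0) is a cocycle pair for every cocycle \<alpha> of \<open>C\<close>.
  Thus one vanishing result yields both injectivity and surjectivity. The other obstacle is that
  \<open>comult C c\<close> is a coset and the cap product picks a representative by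
  \<open>SOME\<close>: each computation first needs independence of that choice and then a
  representative suited to it.\<close>

text \<open>
  By Zorn, take a maximal section \<open>R\<close> (as a graph) over the elements of \<open>N\<close> supported in a set
  \<open>J\<close> of coordinates. It extends to a further coordinate \<open>e\<close>, because the \<open>e\<close>-coordinates of the
  elements supported in \<open>J \<union> {e}\<close> form a principal ideal.
\<close>

lemma split_over_submodule_of_free:
  fixes s :: "'k::principal_ideal_domain \<Rightarrow> 'a::ab_group_add \<Rightarrow> 'a"
    and t :: "'k \<Rightarrow> 'b::ab_group_add \<Rightarrow> 'b"
    and \<pi> :: "'i \<Rightarrow> 'a \<Rightarrow> 'k"
  assumes t: "module t"
    and N: "module.subspace s N" and P: "module.subspace t P"
    and g: "k_linear_on P t s g" and sur: "N \<subseteq> g ` P"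
    and \<pi>: "\<And>i. module_hom s (*) (\<pi> i)"
    and fin: "\<And>x. finite {i. \<pi> i x \<noteq> 0}"
    and inj: "\<And>x. (\<And>i. \<pi> i x = 0) \<Longrightarrow> x = 0"
  shows "\<exists>\<sigma>. k_linear_on N s t \<sigma> \<and> (\<forall>x\<in>N. \<sigma> x \<in> P \<and> g (\<sigma> x) = x)"
proof -
  interpret s: module s using \<pi>[THEN module_hom.axioms(1)] .
  interpret t: module t by fact
  have \<pi>_add [simp]: "\<pi> i (x + y) = \<pi> i x + \<pi> i y"
    and \<pi>_scale [simp]: "\<pi> i (s r x) = r * \<pi> i x"
    and \<pi>_diff [simp]: "\<pi> i (x - y) = \<pi> i x - \<pi> i y"
    and \<pi>_zero [simp]: "\<pi> i 0 = 0" for i r x y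
    using \<pi>[of i] by (auto simp: module_hom.add module_hom.scale module_hom.diff module_hom.zero)
  have g_add: "g (x + y) = g x + g y" if "x \<in> P" "y \<in> P" for x y
    using g that by (auto simp: k_linear_on_def)
  have g_scale: "g (t r x) = s r (g x)" if "x \<in> P" for r x
    using g that by (auto simp: k_linear_on_def)
  define sub where "sub J = {x \<in> N. \<forall>i. \<pi> i x \<noteq> 0 \<longrightarrow> i \<in> J}" for J
  \<comment> \<open>Keeping partial sections as graphs makes inclusion the extension order and the
    union of a chain the obvious upper bound.\<close>
  define sec where "sec J R \<longleftrightarrow> Domain R = sub J \<and> single_valued R \<and>
      (\<forall>x y x' y'. (x, y) \<in> R \<longrightarrow> (x', y') \<in> R \<longrightarrow> (x + x', y + y') \<in> R) \<and>
      (\<forall>r x y. (x, y) \<in> R \<longrightarrow> (s r x, t r y) \<in> R) \<and>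
      (\<forall>x y. (x, y) \<in> R \<longrightarrow> y \<in> P \<and> g y = x)" for J and R :: "('a \<times> 'b) set"
  define A where "A = {(J, R). sec J R}"
  define le where "le p q \<longleftrightarrow> fst p \<subseteq> fst q \<and> snd p \<subseteq> snd q"
    for p q :: "'i set \<times> ('a \<times> 'b) set"
  have empty: "sec {} {(0, 0)}"
    using inj N P g_scale[of 0 0]
    by (auto simp: sec_def sub_def s.subspace_0 t.subspace_0 single_valued_def)
  have "\<exists>m\<in>A. \<forall>a\<in>A. le m a \<longrightarrow> a = m"
  proof (rule predicate_Zorn)
    show "partial_order_on A (relation_of le A)"
      by (rule partial_order_on_relation_ofI) (auto simp: le_def prod_eq_iff)
    fix X assume X: "X \<in> Chains (relation_of le A)"
    have XA: "X \<subseteq> A" using X by (rule Chains_relation_of)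
    have tot: "le p q \<or> le q p" if "p \<in> X" "q \<in> X" for p q
      using X that by (auto simp: Chains_def relation_of_def)
    have secX: "sec (fst p) (snd p)" if "p \<in> X" for p
      using XA that by (auto simp: A_def)
    show "\<exists>u\<in>A. \<forall>a\<in>X. le a u"
    proof (cases "X = {}")
      case True
      then show ?thesis using empty by (auto simp: A_def)
    next
      case False
      define J where "J = \<Union>(fst ` X)"
      define R where "R = \<Union>(snd ` X)"
      have two: "\<exists>p\<in>X. u \<in> snd p \<and> v \<in> snd p" if uv: "u \<in> R" "v \<in> R" for u v
      proof -
        obtain p q where "p \<in> X" "q \<in> X" "u \<in> snd p" "v \<in> snd q"
          using uv by (auto simp: R_def)
        then show ?thesis using tot[of p q] by (auto simp: le_def)
      qed
      \<comment> \<open>The support of \<open>x\<close> is finite, hence already contained in the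
        index set of one member of the chain.\<close>
      have dom: "x \<in> Domain R" if x: "x \<in> sub J" for x
      proof -
        have "{i. \<pi> i x \<noteq> 0} \<subseteq> \<Union>(fst ` X)" using x by (auto simp: sub_def J_def)
        moreover have "subset.chain UNIV (fst ` X)"
          using tot unfolding le_def subset_chain_def by blast
        ultimately obtain K where "K \<in> fst ` X" "{i. \<pi> i x \<noteq> 0} \<subseteq> K"
          using finite_subset_Union_chain[OF fin, of x "fst ` X" UNIV] False by blast
        then obtain p where p: "p \<in> X" "{i. \<pi> i x \<noteq> 0} \<subseteq> fst p" by auto
        then have "x \<in> sub (fst p)" using x by (auto simp: sub_def)
        then have "x \<in> Domain (snd p)" using secX[OF p(1)] by (simp add: sec_def)
        then show ?thesis using p(1) unfolding R_def by blast
      qed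
      have "sec J R"
        unfolding sec_def
      proof (intro conjI allI impI)
        show "Domain R = sub J"
        proof (intro equalityI subsetI)
          fix x assume "x \<in> Domain R"
          then obtain p where p: "p \<in> X" "x \<in> Domain (snd p)" unfolding R_def by blast
          then have "x \<in> sub (fst p)" using secX by (auto simp: sec_def)
          then show "x \<in> sub J" using p by (auto simp: sub_def J_def)
        qed (rule dom)
        show "single_valued R"
        proof (rule single_valuedI)
          fix x y z assume "(x, y) \<in> R" "(x, z) \<in> R"
          then obtain p where "p \<in> X" "(x, y) \<in> snd p" "(x, z) \<in> snd p" using two by blast
          then show "y = z" using secX by (auto simp: sec_def single_valued_def)
        qed
      next
        fix x y x' y' assume "(x, y) \<in> R" "(x', y') \<in> R"
        then obtain p where p: "p \<in> X" "(x, y) \<in> snd p" "(x', y') \<in> snd p" using two by blast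
        then have "(x + x', y + y') \<in> snd p" using secX unfolding sec_def by blast
        then show "(x + x', y + y') \<in> R" using p by (auto simp: R_def)
      next
        fix r x y assume "(x, y) \<in> R"
        then obtain p where p: "p \<in> X" "(x, y) \<in> snd p" using two by blast
        then have "(s r x, t r y) \<in> snd p" using secX unfolding sec_def by blast
        then show "(s r x, t r y) \<in> R" using p by (auto simp: R_def)
      next
        fix x y assume "(x, y) \<in> R"
        then obtain p where p: "p \<in> X" "(x, y) \<in> snd p" using two by blast
        then have "y \<in> P \<and> g y = x" using secX unfolding sec_def by blast
        then show "y \<in> P" "g y = x" by auto
      qed
      then show ?thesis
        by (intro bexI[of _ "(J, R)"]) (auto simp: A_def le_def J_def R_def)
    qed
  qed
  then obtain J R where JR: "sec J R"
    and max: "\<And>J' R'. sec J' R' \<Longrightarrow> J \<subseteq> J' \<Longrightarrow> R \<subseteq> R' \<Longrightarrow> J' = J \<and> R' = R"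
    by (force simp: A_def le_def)
  have R_dom: "Domain R = sub J"
    and R_sv: "\<And>x y y'. (x, y) \<in> R \<Longrightarrow> (x, y') \<in> R \<Longrightarrow> y = y'"
    and R_add: "\<And>x y x' y'. (x, y) \<in> R \<Longrightarrow> (x', y') \<in> R \<Longrightarrow> (x + x', y + y') \<in> R"
    and R_scale: "\<And>r x y. (x, y) \<in> R \<Longrightarrow> (s r x, t r y) \<in> R"
    and R_P: "\<And>x y. (x, y) \<in> R \<Longrightarrow> y \<in> P"
    and R_g: "\<And>x y. (x, y) \<in> R \<Longrightarrow> g y = x"
    using JR unfolding sec_def single_valued_def by blast+
  have "e \<in> J" for e
  proof (rule ccontr)
    assume e: "e \<notin> J"
    let ?K = "insert e J"
    define I where "I = \<pi> e ` sub ?K"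
    have sub_0: "0 \<in> sub K" for K
      using N by (auto simp: sub_def s.subspace_0)
    have sub_add: "x + y \<in> sub K" if "x \<in> sub K" "y \<in> sub K" for x y K
      using that N unfolding sub_def by (simp add: s.subspace_add) (metis add.right_neutral)
    have sub_scale: "s r x \<in> sub K" if "x \<in> sub K" for r x K
      using that N by (auto simp: sub_def s.subspace_scale)
    have "\<exists>a. I = range (\<lambda>r. r * a)"
    proof (rule principal_ideal)
      show "0 \<in> I" using sub_0[of ?K] by (auto simp: I_def intro!: image_eqI[of _ _ 0])
      show "x + y \<in> I" if xy: "x \<in> I" "y \<in> I" for x y
      proof -
        obtain u v where "u \<in> sub ?K" "v \<in> sub ?K" "x = \<pi> e u" "y = \<pi> e v"
          using xy by (auto simp: I_def)
        then show ?thesis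
          using sub_add[of u ?K v] by (auto simp: I_def intro!: image_eqI[of _ _ "u + v"])
      qed
      show "r * x \<in> I" if x: "x \<in> I" for r x
      proof -
        obtain u where "u \<in> sub ?K" "x = \<pi> e u" using x by (auto simp: I_def)
        then show ?thesis
          using sub_scale[of u ?K r] by (auto simp: I_def intro!: image_eqI[of _ _ "s r u"])
      qed
    qed
    then obtain a where a: "I = range (\<lambda>r. r * a)" ..
    show False
    proof (cases "a = 0")
      case True
      \<comment> \<open>The new coordinate vanishes on all of \<open>sub ?K\<close>, so
        \<open>R\<close> itself is a section for \<open>?K\<close>. This contradicts maximality
        because the order also compares the index sets.\<close>
      have "sub ?K = sub J"
      proof (intro equalityI subsetI)
        fix x assume x: "x \<in> sub ?K"
        then have "\<pi> e x \<in> I" by (auto simp: I_def)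
        then have "\<pi> e x = 0" using a True by auto
        then show "x \<in> sub J" using x by (auto simp: sub_def)
      qed (auto simp: sub_def)
      then have "sec ?K R" using JR by (simp add: sec_def)
      then show False using max[of ?K R] e by auto
    next
      case False
      have "a \<in> I" using a by (auto intro!: image_eqI[of _ _ 1])
      then obtain b where b: "b \<in> sub ?K" "\<pi> e b = a" by (auto simp: I_def)
      then have "b \<in> g ` P" using sur by (auto simp: sub_def)
      then obtain w where w: "w \<in> P" "g w = b" by auto
      \<comment> \<open>\<open>b\<close> has the generator \<open>a\<close> as its
        \<open>e\<close>-coordinate, so each element of \<open>sub ?K\<close> is a multiple of
        \<open>b\<close> plus an element of \<open>sub J\<close>. The extension sends
        \<open>b\<close> to the chosen preimage \<open>w\<close>.\<close>
      define R' where "R' = {(x + s r b, y + t r w) | x y r. (x, y) \<in> R}"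
      have Re: "\<pi> e x = 0" "x \<in> sub J" if "(x, y) \<in> R" for x y
        using R_dom that e by (auto simp: sub_def)
      have "sec ?K R'"
        unfolding sec_def
      proof (intro conjI allI impI)
        show "Domain R' = sub ?K"
        proof (intro equalityI subsetI)
          fix x assume "x \<in> Domain R'"
          then obtain u v r where u: "x = u + s r b" "(u, v) \<in> R" unfolding R'_def by blast
          then have "u \<in> sub ?K" using Re(2) by (auto simp: sub_def)
          then show "x \<in> sub ?K" using u b sub_add sub_scale by simp
        next
          fix x assume x: "x \<in> sub ?K"
          then have "\<pi> e x \<in> I" by (auto simp: I_def)
          then obtain r where r: "\<pi> e x = r * a" using a by auto
          have "x + s (- r) b \<in> sub ?K" using x b by (intro sub_add sub_scale)
          then have "x - s r b \<in> sub J" using r b by (auto simp: sub_def)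
          then obtain y where "(x - s r b, y) \<in> R" using R_dom by blast
          then have "(x - s r b + s r b, y + t r w) \<in> R'" unfolding R'_def by blast
          then show "x \<in> Domain R'" by auto
        qed
        show "single_valued R'"
        proof (rule single_valuedI)
          fix x y z assume "(x, y) \<in> R'" "(x, z) \<in> R'"
          then obtain u v r u' v' r' where h: "x = u + s r b" "y = v + t r w" "(u, v) \<in> R"
            "x = u' + s r' b" "z = v' + t r' w" "(u', v') \<in> R"
            unfolding R'_def by blast
          have "\<pi> e x = r * a" unfolding h(1) using Re(1)[OF h(3)] b by simp
          moreover have "\<pi> e x = r' * a" unfolding h(4) using Re(1)[OF h(6)] b by simp
          ultimately have "r * a = r' * a" by metis
          \<comment> \<open>Cancelling \<open>a\<close> uses that the ring is a domain: the multiple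
            of \<open>b\<close> in the decomposition is unique.\<close>
          then have "r = r'" using False by simp
          moreover from this have "u = u'" using h by simp
          ultimately show "y = z" using h R_sv by auto
        qed
      next
        fix x y x' y' assume "(x, y) \<in> R'" "(x', y') \<in> R'"
        then obtain u v r u' v' r' where h: "x = u + s r b" "y = v + t r w" "(u, v) \<in> R"
            "x' = u' + s r' b" "y' = v' + t r' w" "(u', v') \<in> R"
          unfolding R'_def by blast
        have "(u + u' + s (r + r') b, v + v' + t (r + r') w) \<in> R'"
          using R_add[OF h(3,6)] unfolding R'_def by blast
        then show "(x + x', y + y') \<in> R'"
          by (simp add: h s.scale_left_distrib t.scale_left_distrib ac_simps)
      next
        fix q x y assume "(x, y) \<in> R'"
        then obtain u v r where h: "x = u + s r b" "y = v + t r w" "(u, v) \<in> R"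
          unfolding R'_def by blast
        have "(s q u + s (q * r) b, t q v + t (q * r) w) \<in> R'"
          using R_scale[OF h(3)] unfolding R'_def by blast
        then show "(s q x, t q y) \<in> R'"
          by (simp add: h s.scale_right_distrib t.scale_right_distrib)
      next
        fix x y assume "(x, y) \<in> R'"
        then obtain u v r where h: "x = u + s r b" "y = v + t r w" "(u, v) \<in> R"
          unfolding R'_def by blast
        have v: "v \<in> P" "g v = u" using h R_P R_g by auto
        have tw: "t r w \<in> P" using w P by (simp add: t.subspace_scale)
        show "y \<in> P" using h v tw P by (simp add: t.subspace_add)
        show "g y = x" using h v tw w by (simp add: g_add g_scale)
      qed
      moreover have "R \<subseteq> R'"
      proof
        fix z assume "z \<in> R"
        then have "(fst z, snd z) \<in> R" by simp
        then have "(fst z + s 0 b, snd z + t 0 w) \<in> R'" unfolding R'_def by blast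
        then show "z \<in> R'" by simp
      qed
      ultimately show False using max[of ?K R'] e by auto
    qed
  qed
  then have "sub J = N" by (auto simp: sub_def)
  then have ex: "\<exists>y. (x, y) \<in> R" if "x \<in> N" for x using R_dom that by blast
  define \<sigma> where "\<sigma> x = (SOME y. (x, y) \<in> R)" for x
  have \<sigma>: "(x, \<sigma> x) \<in> R" if "x \<in> N" for x
    unfolding \<sigma>_def by (rule someI_ex[OF ex[OF that]])
  have "k_linear_on N s t \<sigma>"
    unfolding k_linear_on_def
  proof (intro conjI ballI allI)
    fix x y assume "x \<in> N" "y \<in> N"
    then show "\<sigma> (x + y) = \<sigma> x + \<sigma> y"
      using R_sv[OF \<sigma> R_add[OF \<sigma> \<sigma>]] N by (simp add: s.subspace_add)
  next
    fix r x assume "x \<in> N"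
    then show "\<sigma> (s r x) = t r (\<sigma> x)"
      using R_sv[OF \<sigma> R_scale[OF \<sigma>]] N by (simp add: s.subspace_scale)
  qed
  then show ?thesis using \<sigma> R_P R_g by blast
qed

subsection \<open>Graded modules\<close>

locale graded_module = module s
  for s :: "'k::comm_ring_1 \<Rightarrow> 'a::ab_group_add \<Rightarrow> 'a" +
  fixes G :: "int \<Rightarrow> 'a set"
  assumes subspace_grade: "subspace (G n)"
    and direct: "direct_family G"
begin

text \<open>This is literally the predicate under \<open>THE\<close> in \<open>component\<close>, so
  uniqueness of decompositions evaluates components.\<close>

abbreviation decomposes :: "(int \<Rightarrow> 'a) \<Rightarrow> 'a \<Rightarrow> bool" where
  "decomposes f x \<equiv> finite {i. f i \<noteq> 0} \<and> (\<forall>i. f i \<in> G i) \<and> (\<Sum>i | f i \<noteq> 0. f i) = x"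

abbreviation carrier :: "'a set" where "carrier \<equiv> span (\<Union>n. G n)"

lemma sum_support: "finite I \<Longrightarrow> {i. f i \<noteq> 0} \<subseteq> I \<Longrightarrow> (\<Sum>i | f i \<noteq> 0. f i) = (\<Sum>i\<in>I. f i)"
  for f :: "int \<Rightarrow> 'b::comm_monoid_add"
  by (rule sum.mono_neutral_left) auto

lemma decomposes_add:
  assumes f: "decomposes f x" and h: "decomposes h y"
  shows "decomposes (\<lambda>i. f i + h i) (x + y)"
proof -
  let ?I = "{i. f i \<noteq> 0} \<union> {i. h i \<noteq> 0}"
  have I: "finite ?I" "{i. f i + h i \<noteq> 0} \<subseteq> ?I" using f h by auto
  have "(\<Sum>i | f i + h i \<noteq> 0. f i + h i) = (\<Sum>i\<in>?I. f i) + (\<Sum>i\<in>?I. h i)"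
    using sum_support[OF I] by (simp add: sum.distrib)
  also have "\<dots> = x + y"
    using sum_support[OF I(1), of f] sum_support[OF I(1), of h] f h by auto
  finally show ?thesis
    using f h finite_subset[OF I(2,1)] subspace_grade by (auto simp: subspace_add)
qed

lemma decomposes_scale:
  assumes f: "decomposes f x"
  shows "decomposes (\<lambda>i. s r (f i)) (s r x)"
proof -
  have I: "finite {i. f i \<noteq> 0}" "{i. s r (f i) \<noteq> 0} \<subseteq> {i. f i \<noteq> 0}" using f by auto
  have "(\<Sum>i | s r (f i) \<noteq> 0. s r (f i)) = s r x"
    using sum_support[OF I] f by (auto simp: scale_sum_right)
  then show ?thesis
    using f finite_subset[OF I(2,1)] subspace_grade by (auto simp: subspace_scale)
qed

lemma decomposes_single:
  assumes "x \<in> G m"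
  shows "decomposes (\<lambda>i. if i = m then x else 0) x"
proof -
  have "{i. (if i = m then x else 0) \<noteq> 0} = (if x = 0 then {} else {m})" by auto
  then show ?thesis using assms subspace_grade by (auto simp: subspace_0)
qed

text \<open>Directness speaks only of families with sum 0, so it is applied to the difference,
  written with the scalar -1 to reuse closure under sums and multiples.\<close>

lemma decomposes_unique:
  assumes f: "decomposes f x" and h: "decomposes h x"
  shows "f = h"
proof -
  have "decomposes (\<lambda>i. f i + s (-1) (h i)) (x + s (-1) x)"
    by (intro decomposes_add decomposes_scale f h)
  then have "\<forall>i. f i + s (-1) (h i) = 0"
    using direct[unfolded direct_family_def, rule_format, of "\<lambda>i. f i + s (-1) (h i)"] by simp
  then show ?thesis by (simp add: fun_eq_iff)
qed

lemma component_eq: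
  assumes "decomposes f x"
  shows "component G n x = f n"
proof -
  have "(THE f. decomposes f x) = f"
    by (rule the_equality) (use assms decomposes_unique in metis)+
  then show ?thesis by (simp add: component_def)
qed

lemma decomposes_component:
  assumes "x \<in> carrier"
  shows "decomposes (\<lambda>i. component G i x) x"
proof -
  have "\<exists>f. decomposes f x"
    using assms
  proof (induction rule: span_induct_alt)
    case base
    show ?case using subspace_grade by (intro exI[of _ "\<lambda>_. 0"]) (auto simp: subspace_0)
  next
    case (step c x y)
    then obtain n f where "x \<in> G n" "decomposes f y" by blast
    then have "decomposes (\<lambda>i. s c (if i = n then x else 0) + f i) (s c x + y)"
      by (intro decomposes_add decomposes_scale decomposes_single)
    then show ?case by (intro exI[of _ "\<lambda>i. s c (if i = n then x else 0) + f i"])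
  qed
  then obtain f where f: "decomposes f x" ..
  then have "component G i x = f i" for i by (rule component_eq)
  then show ?thesis using f by simp
qed

lemma finite_degrees: "x \<in> carrier \<Longrightarrow> finite (degrees G x)"
  using decomposes_component by (simp add: degrees_def)

lemma component_in_grade: "x \<in> carrier \<Longrightarrow> component G n x \<in> G n"
  using decomposes_component by blast

lemma sum_component: "x \<in> carrier \<Longrightarrow> (\<Sum>i\<in>degrees G x. component G i x) = x"
  using decomposes_component by (simp add: degrees_def)

lemma component_add:
  "x \<in> carrier \<Longrightarrow> y \<in> carrier \<Longrightarrow> component G n (x + y) = component G n x + component G n y"
  using component_eq[OF decomposes_add[OF decomposes_component decomposes_component]] .

lemma component_scale: "x \<in> carrier \<Longrightarrow> component G n (s r x) = s r (component G n x)"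
  using component_eq[OF decomposes_scale[OF decomposes_component]] .

lemma component_homogeneous: "x \<in> G m \<Longrightarrow> component G n x = (if n = m then x else 0)"
  using component_eq[OF decomposes_single] .

lemma degrees_homogeneous: "x \<in> G m \<Longrightarrow> degrees G x = (if x = 0 then {} else {m})"
  by (auto simp: degrees_def component_homogeneous)

lemma grade_subset_carrier: "x \<in> G m \<Longrightarrow> x \<in> carrier"
  by (intro span_base) auto

text \<open>Zero lies in every grade but has an empty set of degrees; the condition on
  \<open>F m 0\<close> makes the formula correct there too.\<close>

lemma sum_degrees_homogeneous:
  "x \<in> G m \<Longrightarrow> F m 0 = 0 \<Longrightarrow> (\<Sum>i\<in>degrees G x. F i (component G i x)) = F m x"
  by (simp add: degrees_homogeneous component_homogeneous)

lemma sum_degrees_superset: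
  assumes "finite I" "degrees G x \<subseteq> I" "\<And>i. F i 0 = 0"
  shows "(\<Sum>i\<in>degrees G x. F i (component G i x)) = (\<Sum>i\<in>I. F i (component G i x))"
  using assms by (intro sum.mono_neutral_left) (auto simp: degrees_def)

text \<open>Every operation defined by its values on homogeneous elements is such a sum. The three
  sums run over different sets of degrees, since components may cancel in \<open>x + y\<close>, and
  are therefore compared over the union of these sets.\<close>

lemma sum_degrees_add:
  fixes F :: "int \<Rightarrow> 'a \<Rightarrow> 'b::ab_group_add"
  assumes F: "\<And>i x y. x \<in> G i \<Longrightarrow> y \<in> G i \<Longrightarrow> F i (x + y) = F i x + F i y"
    and x: "x \<in> carrier" and y: "y \<in> carrier"
  shows "(\<Sum>i\<in>degrees G (x + y). F i (component G i (x + y))) =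
    (\<Sum>i\<in>degrees G x. F i (component G i x)) + (\<Sum>i\<in>degrees G y. F i (component G i y))"
proof -
  have F0: "F i 0 = 0" for i using F[of 0 i 0] subspace_grade by (simp add: subspace_0)
  define I where "I = degrees G (x + y) \<union> degrees G x \<union> degrees G y"
  have I: "finite I" using x y by (simp add: I_def finite_degrees span_add)
  have sup: "(\<Sum>i\<in>degrees G z. F i (component G i z)) = (\<Sum>i\<in>I. F i (component G i z))"
    if "z \<in> {x + y, x, y}" for z
    using that by (intro sum_degrees_superset I F0) (auto simp: I_def)
  show ?thesis
    unfolding sup[of "x + y", simplified] sup[of x, simplified] sup[of y, simplified]
    using F x y by (simp add: component_add component_in_grade sum.distrib)
qed

lemma sum_degrees_scale:
  fixes F :: "int \<Rightarrow> 'a \<Rightarrow> 'b::ab_group_add"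
  assumes t: "module t"
    and F: "\<And>i x. x \<in> G i \<Longrightarrow> F i (s r x) = t r (F i x)" and F0: "\<And>i. F i 0 = 0"
    and x: "x \<in> carrier"
  shows "(\<Sum>i\<in>degrees G (s r x). F i (component G i (s r x))) =
    t r (\<Sum>i\<in>degrees G x. F i (component G i x))"
proof -
  interpret t: module t by fact
  define I where "I = degrees G (s r x) \<union> degrees G x"
  have I: "finite I" using x by (simp add: I_def finite_degrees span_scale)
  have sup: "(\<Sum>i\<in>degrees G z. F i (component G i z)) = (\<Sum>i\<in>I. F i (component G i z))"
    if "z \<in> {s r x, x}" for z
    using that by (intro sum_degrees_superset I F0) (auto simp: I_def)
  show ?thesis
    unfolding sup[of "s r x", simplified] sup[of x, simplified]
    using F x by (simp add: component_scale component_in_grade t.scale_sum_right)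
qed

text \<open>There is no case for multiples: grades are submodules, so a multiple of a homogeneous
  element is again homogeneous.\<close>

lemma carrier_induct [consumes 1, case_names zero add homogeneous]:
  assumes x: "x \<in> carrier"
    and zero: "P 0"
    and add: "\<And>x y. x \<in> carrier \<Longrightarrow> y \<in> carrier \<Longrightarrow> P x \<Longrightarrow> P y \<Longrightarrow> P (x + y)"
    and hom: "\<And>n x. x \<in> G n \<Longrightarrow> P x"
  shows "P x"
proof -
  have "x \<in> carrier \<and> P x"
    using x
  proof (induction rule: span_induct_alt)
    case base
    show ?case using zero by (simp add: span_zero)
  next
    case (step c x y)
    then obtain n where "x \<in> G n" by blast
    then have "s c x \<in> G n" using subspace_grade by (simp add: subspace_scale)
    then show ?case using step add hom grade_subset_carrier by (simp add: span_add)
  qed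
  then show ?thesis ..
qed

end

lemma dg_module_graded: "is_dg_module M \<Longrightarrow> graded_module (scale M) (grade M)"
  by (simp add: is_dg_module_def graded_module_def graded_module_axioms_def)

subsection \<open>Linear extension and tensor relations\<close>

lemma lookup_fscale [simp]: "Poly_Mapping.lookup (fscale r p) x = r * Poly_Mapping.lookup p x"
  by (simp add: fscale_def Poly_Mapping.map.rep_eq when_def)

lemma module_fscale: "module (fscale :: 'k::comm_ring_1 \<Rightarrow> ('a \<Rightarrow>\<^sub>0 'k) \<Rightarrow> _)"
  by standard (auto intro!: poly_mapping_eqI simp: lookup_add algebra_simps)

lemma lin_ext_superset:
  assumes "module s" "finite A" "Poly_Mapping.keys p \<subseteq> A"
  shows "lin_ext s g p = (\<Sum>x\<in>A. s (Poly_Mapping.lookup p x) (g x))"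
proof -
  interpret module s by fact
  show ?thesis
    unfolding lin_ext_def using assms by (intro sum.mono_neutral_left) (auto simp: in_keys_iff)
qed

lemma module_hom_lin_ext:
  fixes s :: "'c::comm_ring_1 \<Rightarrow> 'b::ab_group_add \<Rightarrow> 'b" and g :: "'a \<Rightarrow> 'b"
  assumes "module s"
  shows "module_hom fscale s (lin_ext s g)"
proof -
  interpret s: module s by fact
  interpret f: module "fscale :: 'c \<Rightarrow> ('a \<Rightarrow>\<^sub>0 'c) \<Rightarrow> _" by (rule module_fscale)
  show ?thesis
  proof
    fix p q :: "'a \<Rightarrow>\<^sub>0 'c"
    let ?A = "Poly_Mapping.keys p \<union> Poly_Mapping.keys q \<union> Poly_Mapping.keys (p + q)"
    show "lin_ext s g (p + q) = lin_ext s g p + lin_ext s g q"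
      by (simp add: lin_ext_superset[OF assms, of ?A] Un_assoc lookup_add s.scale_left_distrib
          sum.distrib le_supI1 le_supI2)
  next
    fix r and p :: "'a \<Rightarrow>\<^sub>0 'c"
    let ?A = "Poly_Mapping.keys p \<union> Poly_Mapping.keys (fscale r p)"
    show "lin_ext s g (fscale r p) = s r (lin_ext s g p)"
      by (simp add: lin_ext_superset[OF assms, of ?A] s.scale_sum_right)
  qed
qed

lemmas lin_ext_add = module_hom.add[OF module_hom_lin_ext]
  and lin_ext_fscale = module_hom.scale[OF module_hom_lin_ext]
  and lin_ext_diff = module_hom.diff[OF module_hom_lin_ext]
  and lin_ext_zero = module_hom.zero[OF module_hom_lin_ext]
  and lin_ext_sum = module_hom.sum[OF module_hom_lin_ext]

lemma lin_ext_gen: "module s \<Longrightarrow> lin_ext s g (gen x) = g x"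
  by (simp add: lin_ext_def gen_def module.scale_one)

lemma lin_ext_hom:
  assumes "module_hom s t h"
  shows "h (lin_ext s g p) = lin_ext t (\<lambda>x. h (g x)) p"
  by (simp add: lin_ext_def module_hom.sum[OF assms] module_hom.scale[OF assms])

lemma lin_ext_fun_add:
  "module s \<Longrightarrow> lin_ext s (\<lambda>x. g x + h x) p = lin_ext s g p + lin_ext s h p"
  by (simp add: lin_ext_def module.scale_right_distrib sum.distrib)

lemma lin_ext_fun_scale:
  "module s \<Longrightarrow> lin_ext s (\<lambda>x. s r (g x)) p = s r (lin_ext s g p)"
  by (simp add: lin_ext_def module.scale_sum_right module.scale_scale mult.commute)

lemma lin_ext_lin_ext:
  "module s \<Longrightarrow> lin_ext s g (lin_ext fscale u p) = lin_ext s (\<lambda>x. lin_ext s g (u x)) p"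
  by (rule lin_ext_hom[OF module_hom_lin_ext])

lemma span_fscale_induct [consumes 1, case_names zero add scale base]:
  assumes "p \<in> module.span fscale S"
    and "P 0" and "\<And>p q. P p \<Longrightarrow> P q \<Longrightarrow> P (p + q)" and "\<And>r p. P p \<Longrightarrow> P (fscale r p)"
    and "\<And>p. p \<in> S \<Longrightarrow> P p"
  shows "P p"
  using assms(1)
proof (rule module.span_induct_alt[OF module_fscale])
  show "P 0" by fact
  show "P (fscale c x + y)" if "x \<in> S" "P y" for c x y
    using assms(3-5) that by simp
qed

definition bilinear_map ::
  "('k::comm_ring_1 \<Rightarrow> 'a::ab_group_add \<Rightarrow> 'a) \<Rightarrow> ('k \<Rightarrow> 'b::ab_group_add \<Rightarrow> 'b)
    \<Rightarrow> ('k \<Rightarrow> 'e::ab_group_add \<Rightarrow> 'e) \<Rightarrow> ('a \<Rightarrow> 'b \<Rightarrow> 'e) \<Rightarrow> bool" where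
  "bilinear_map s t u b \<longleftrightarrow>
    (\<forall>y. module_hom s u (\<lambda>x. b x y)) \<and> (\<forall>x. module_hom t u (b x))"

text \<open>The universal property of the tensor product in the form used here: a bilinear map
  extended to the free module on pairs depends only on the coset.\<close>

lemma lin_ext_tensor_rel:
  assumes b: "bilinear_map s t u b" and p: "p \<in> tensor_rel s t"
  shows "lin_ext u (\<lambda>(x, y). b x y) p = 0"
proof -
  have u: "module u" using b by (auto simp: bilinear_map_def module_hom_def)
  interpret u: module u by fact
  have [simp]: "b (x + x') y = b x y + b x' y" "b (s r x) y = u r (b x y)"
    "b x (y + y') = b x y + b x y'" "b x (t r y) = u r (b x y)" for x x' y y' r
    using b module_hom.add[of s u "\<lambda>x. b x y"] module_hom.scale[of s u "\<lambda>x. b x y"]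
      module_hom.add[of t u "b x"] module_hom.scale[of t u "b x"]
    by (auto simp: bilinear_map_def)
  note lin = lin_ext_add[OF u] lin_ext_fscale[OF u] lin_ext_diff[OF u] lin_ext_zero[OF u]
    lin_ext_gen[OF u]
  show ?thesis
    using p unfolding tensor_rel_def
    by (induction rule: span_fscale_induct) (auto simp: lin)
qed

text \<open>The analogue for three factors, through which coassociativity is applied.\<close>

lemma lin_ext_tensor3_rel:
  assumes b1: "\<And>y z. module_hom s u (\<lambda>x. b x y z)"
    and b2: "\<And>x z. module_hom s u (\<lambda>y. b x y z)"
    and b3: "\<And>x y. module_hom s u (b x y)"
    and p: "p \<in> tensor3_rel s"
  shows "lin_ext u (\<lambda>(x, y, z). b x y z) p = 0"
proof -
  have u: "module u" using b1 by (auto simp: module_hom_def)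
  interpret u: module u by fact
  have [simp]: "b (x + x') y z = b x y z + b x' y z" "b (s r x) y z = u r (b x y z)"
    "b x (y + y') z = b x y z + b x y' z" "b x (s r y) z = u r (b x y z)"
    "b x y (z + z') = b x y z + b x y z'" "b x y (s r z) = u r (b x y z)" for x x' y y' z z' r
    using module_hom.add[OF b1[of y z]] module_hom.scale[OF b1[of y z]]
      module_hom.add[OF b2[of x z]] module_hom.scale[OF b2[of x z]]
      module_hom.add[OF b3[of x y]] module_hom.scale[OF b3[of x y]] by auto
  note lin = lin_ext_add[OF u] lin_ext_fscale[OF u] lin_ext_diff[OF u] lin_ext_zero[OF u]
    lin_ext_gen[OF u]
  show ?thesis
    using p unfolding tensor3_rel_def
    by (induction rule: span_fscale_induct) (auto simp: lin)
qed

lemma sgn_pow_mult: "sgn_pow m * sgn_pow n = sgn_pow (m + n)"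
  by (auto simp: sgn_pow_def)

lemma sgn_pow_cong: "(even m \<longleftrightarrow> even n) \<Longrightarrow> sgn_pow m = sgn_pow n"
  by (simp add: sgn_pow_def)

lemma sgn_pow_square [simp]: "sgn_pow n * sgn_pow n = 1"
  by (simp add: sgn_pow_def)

lemma lin_ext_twist:
  assumes "module s"
  shows "lin_ext s g (twist G H x y) =
    (\<Sum>i\<in>degrees G x. \<Sum>j\<in>degrees H y. s (sgn_pow (i * j)) (g (component H j y, component G i x)))"
  by (simp add: twist_def lin_ext_sum[OF assms] lin_ext_fscale[OF assms] lin_ext_gen[OF assms])

subsection \<open>The dual of a coalgebra\<close>

lemma module_mult: "module ((*) :: 'k::comm_ring_1 \<Rightarrow> 'k \<Rightarrow> 'k)"
  by standard (auto simp: algebra_simps)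

lemma module_hom_compI:
  "module_hom s t f \<Longrightarrow> module_hom t u g \<Longrightarrow> module_hom s u (\<lambda>x. g (f x))"
  using module_hom_compose[of s t f u g] by (simp add: o_def)

lemma sum_fun_apply: "(\<Sum>i\<in>I. f i) x = (\<Sum>i\<in>I. f i x)"
  for f :: "'i \<Rightarrow> 'a \<Rightarrow> 'b::comm_monoid_add"
  by (induction I rule: infinite_finite_induct) auto

locale dg_coalg =
  fixes C :: "('k::comm_ring_1, 'a::ab_group_add) dg_coalgebra"
  assumes coalgebra: "is_dg_coalgebra C"
begin

abbreviation s where "s \<equiv> scale C"
abbreviation G where "G \<equiv> grade C"
abbreviation H where "H \<equiv> dual_grade C"
abbreviation d where "d \<equiv> diff C"
abbreviation (input) s_dual :: "'k \<Rightarrow> ('a \<Rightarrow> 'k) \<Rightarrow> 'a \<Rightarrow> 'k" where "s_dual \<equiv> (\<lambda>r \<phi> x. r * \<phi> x)"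

lemma dg_module: "is_dg_module C"
  using coalgebra by (simp add: is_dg_coalgebra_def)

sublocale graded_module "scale C" "grade C"
  by (rule dg_module_graded[OF dg_module])

lemma total_UNIV: "total C = UNIV"
  using coalgebra by (simp add: is_dg_coalgebra_def)

lemma carrier_UNIV [simp]: "carrier = UNIV"
  using total_UNIV by (simp add: total_def)

lemma module_hom_diff: "module_hom s s d"
  using dg_module total_UNIV module_axioms
  by (auto simp: is_dg_module_def k_linear_on_def module_hom_iff)

lemma diff_grade: "x \<in> G i \<Longrightarrow> d x \<in> G (i - 1)"
  using dg_module by (auto simp: is_dg_module_def)

lemma diff_diff [simp]: "d (d x) = 0"
  using dg_module total_UNIV by (auto simp: is_dg_module_def)

lemmas diff_add = module_hom.add[OF module_hom_diff]
  and diff_scale = module_hom.scale[OF module_hom_diff]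
  and diff_zero = module_hom.zero[OF module_hom_diff]

lemma dual_hom: "\<phi> \<in> H m \<Longrightarrow> module_hom s (*) \<phi>"
  by (simp add: dual_grade_def)

lemmas dual_add = module_hom.add[OF dual_hom]
  and dual_scale = module_hom.scale[OF dual_hom]
  and dual_zero = module_hom.zero[OF dual_hom]

lemma dual_vanish: "\<phi> \<in> H m \<Longrightarrow> x \<in> G i \<Longrightarrow> i + m \<noteq> 0 \<Longrightarrow> \<phi> x = 0"
  by (simp add: dual_grade_def)

lemma sum_component_UNIV: "(\<Sum>i\<in>degrees G x. component G i x) = x"
  by (simp add: sum_component)

lemma component_grade: "component G i x \<in> G i"
  by (simp add: component_in_grade)

text \<open>A form of degree \<open>m\<close> sees only the component of degree \<open>- m\<close>,
  so a sign depending on the degree of the argument becomes a constant.\<close>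

lemma sum_degrees_dual:
  assumes \<phi>: "\<phi> \<in> H m"
  shows "(\<Sum>i\<in>degrees G x. a i * \<phi> (component G i x)) = a (- m) * \<phi> x"
proof -
  have "a i * \<phi> (component G i x) = a (- m) * \<phi> (component G i x)" for i
    using dual_vanish[OF \<phi> component_grade[of i x]] by (cases "i = - m") auto
  then have "(\<Sum>i\<in>degrees G x. a i * \<phi> (component G i x)) =
      a (- m) * (\<Sum>i\<in>degrees G x. \<phi> (component G i x))"
    by (simp add: sum_distrib_left)
  also have "(\<Sum>i\<in>degrees G x. \<phi> (component G i x)) = \<phi> x"
    using sum_component_UNIV[of x] module_hom.sum[OF dual_hom[OF \<phi>]] by metis
  finally show ?thesis .
qed

lemma dual_eqI:
  assumes "module_hom s t f" "module_hom s t g" "\<And>i x. x \<in> G i \<Longrightarrow> f x = g x"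
  shows "f x = g x"
proof -
  have "f (component G i x) = g (component G i x)" for i
    using assms(3) component_grade by blast
  then have "f (\<Sum>i\<in>degrees G x. component G i x) = g (\<Sum>i\<in>degrees G x. component G i x)"
    by (simp add: module_hom.sum[OF assms(1)] module_hom.sum[OF assms(2)])
  then show ?thesis by (simp add: sum_component_UNIV)
qed

lemma module_dual: "module s_dual"
  by standard (auto simp: fun_eq_iff algebra_simps)

lemma module_hom_zero_fun: "module_hom s (*) (\<lambda>x. 0)"
  using module_axioms module_mult by (auto simp: module_hom_iff)

lemma module_pair_mult: "module_pair s ((*) :: 'k \<Rightarrow> 'k \<Rightarrow> 'k)"
  using module_axioms module_mult by (simp add: module_pair_def)

lemma dual_gradeI:
  "module_hom s (*) \<phi> \<Longrightarrow> (\<And>i x. x \<in> G i \<Longrightarrow> i + m \<noteq> 0 \<Longrightarrow> \<phi> x = 0) \<Longrightarrow> \<phi> \<in> H m"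
  by (simp add: dual_grade_def)

lemma subspace_dual_grade: "module.subspace s_dual (H n)"
proof (rule module.subspaceI[OF module_dual])
  show "0 \<in> H n"
    using module_hom_zero_fun by (intro dual_gradeI) (simp_all add: zero_fun_def)
next
  fix \<phi> \<psi> assume h: "\<phi> \<in> H n" "\<psi> \<in> H n"
  show "\<phi> + \<psi> \<in> H n"
    using module_pair.module_hom_add[OF module_pair_mult dual_hom[OF h(1)] dual_hom[OF h(2)]]
      dual_vanish[OF h(1)] dual_vanish[OF h(2)]
    by (intro dual_gradeI) (simp_all add: plus_fun_def)
next
  fix r \<phi> assume h: "\<phi> \<in> H n"
  show "s_dual r \<phi> \<in> H n"
    using module_pair.module_hom_scale[OF module_pair_mult dual_hom[OF h]] dual_vanish[OF h] by (intro dual_gradeI) simp_all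
qed

text \<open>On an element of degree \<open>i\<close> only the form of degree \<open>- i\<close> can
  be nonzero, so evaluating the vanishing sum there isolates one summand.\<close>

lemma direct_dual: "direct_family H"
  unfolding direct_family_def
proof (intro allI impI, elim conjE)
  fix f :: "int \<Rightarrow> 'a \<Rightarrow> 'k" and n
  assume fin: "finite {n. f n \<noteq> 0}" and f: "\<forall>n. f n \<in> H n" and sum: "(\<Sum>n | f n \<noteq> 0. f n) = 0"
  have "f n x = 0" if x: "x \<in> G i" for i x
  proof (cases "i + n = 0")
    case True
    have "0 = (\<Sum>k | f k \<noteq> 0. f k x)"
      using arg_cong[OF sum, of "\<lambda>h. h x"] by (simp add: sum_fun_apply)
    also have "\<dots> = (\<Sum>k | f k \<noteq> 0. if k = n then f n x else 0)"
      using True dual_vanish[OF f[rule_format] x] by (intro sum.cong) auto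
    also have "\<dots> = f n x" using fin by (auto simp: sum.delta)
    finally show ?thesis by simp
  next
    case False
    then show ?thesis using dual_vanish[OF f[rule_format] x] by simp
  qed
  then show "f n = 0"
    using dual_eqI[OF dual_hom[OF f[rule_format]] module_hom_zero_fun] by (auto simp: fun_eq_iff)
qed

sublocale dual: graded_module s_dual "dual_grade C"
  using module_dual subspace_dual_grade direct_dual
  by (simp add: graded_module_def graded_module_axioms_def)

lemma dual_simps [simp]: "scale (dual C) = s_dual" "grade (dual C) = H"
  by (simp_all add: dual_def)

lemma total_dual: "total (dual C) = dual.carrier"
  by (simp add: total_def)

lemma diff_dual: "diff (dual C) \<phi> x = - (\<Sum>m\<in>degrees H \<phi>. sgn_pow m * component H m \<phi> (d x))"
  by (simp add: dual_def)

lemma diff_dual_homogeneous: "\<phi> \<in> H m \<Longrightarrow> diff (dual C) \<phi> x = - (sgn_pow m * \<phi> (d x))"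
  using dual.sum_degrees_homogeneous[of \<phi> m "\<lambda>m \<phi>. sgn_pow m * \<phi> (d x)"] by (simp add: diff_dual)

lemma diff_dual_add:
  "\<phi> \<in> dual.carrier \<Longrightarrow> \<psi> \<in> dual.carrier \<Longrightarrow>
    diff (dual C) (\<phi> + \<psi>) = diff (dual C) \<phi> + diff (dual C) \<psi>"
  using dual.sum_degrees_add[of "\<lambda>m \<phi>. sgn_pow m * \<phi> (d x)" \<phi> \<psi> for x]
  by (simp add: diff_dual fun_eq_iff algebra_simps)

lemma diff_dual_scale:
  "\<phi> \<in> dual.carrier \<Longrightarrow> diff (dual C) (s_dual r \<phi>) = s_dual r (diff (dual C) \<phi>)"
  using dual.sum_degrees_scale[OF module_mult, of "\<lambda>m \<phi>. sgn_pow m * \<phi> (d x)" r \<phi> for x]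
  by (simp add: diff_dual fun_eq_iff algebra_simps)

text \<open>A form of degree \<open>m\<close> lives on degree \<open>- m\<close>; its composite with
  the differential lives on degree \<open>- m + 1\<close>. In lower grading the dual differential
  therefore lowers degrees as well.\<close>

lemma comp_diff_dual_grade:
  assumes "\<phi> \<in> H m"
  shows "(\<lambda>x. \<phi> (d x)) \<in> H (m - 1)"
proof (rule dual_gradeI)
  show "module_hom s (*) (\<lambda>x. \<phi> (d x))"
    by (rule module_hom_compI[OF module_hom_diff dual_hom[OF assms]])
  show "\<phi> (d x) = 0" if "x \<in> G i" "i + (m - 1) \<noteq> 0" for i x
    using dual_vanish[OF assms diff_grade[OF that(1)]] that(2) by simp
qed

lemma diff_dual_grade:
  assumes "\<phi> \<in> H m"
  shows "diff (dual C) \<phi> \<in> H (m - 1)"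
proof -
  have "diff (dual C) \<phi> = s_dual (- sgn_pow m) (\<lambda>x. \<phi> (d x))"
    using assms by (simp add: fun_eq_iff diff_dual_homogeneous)
  then show ?thesis
    using comp_diff_dual_grade[OF assms] dual.subspace_grade dual.subspace_scale by metis
qed

lemma diff_dual_carrier:
  assumes "\<phi> \<in> dual.carrier"
  shows "diff (dual C) \<phi> \<in> dual.carrier"
  using assms
proof (induction rule: dual.carrier_induct)
  case zero
  have "diff (dual C) 0 \<in> H (0 - 1)"
    by (rule diff_dual_grade[OF dual.subspace_0[OF subspace_dual_grade]])
  then show ?case by (rule dual.grade_subset_carrier)
next
  case (add \<phi> \<psi>)
  then show "diff (dual C) (\<phi> + \<psi>) \<in> dual.carrier"
    by (simp add: diff_dual_add dual.span_add)
next
  case (homogeneous n \<phi>)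
  then show ?case using diff_dual_grade dual.grade_subset_carrier by blast
qed

lemma diff_dual_zero: "diff (dual C) 0 = 0"
  using diff_dual_add[OF dual.span_zero dual.span_zero] by simp

lemma dg_module_dual: "is_dg_module (dual C)"
proof -
  have "diff (dual C) (diff (dual C) \<phi>) = 0" if "\<phi> \<in> dual.carrier" for \<phi>
    using that
  proof (induction rule: dual.carrier_induct)
    case zero
    show "diff (dual C) (diff (dual C) 0) = 0" by (simp only: diff_dual_zero)
  next
    case (add \<phi> \<psi>)
    have "diff (dual C) (diff (dual C) \<phi>) = 0" "diff (dual C) (diff (dual C) \<psi>) = 0"
      by (fact add)+
    then show "diff (dual C) (diff (dual C) (\<phi> + \<psi>)) = 0"
      using add(1,2) by (simp add: diff_dual_add diff_dual_carrier)
  next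
    case (homogeneous n \<phi>)
    have "diff (dual C) (diff (dual C) \<phi>) x = 0" for x
      by (simp add: diff_dual_homogeneous[OF homogeneous]
          diff_dual_homogeneous[OF diff_dual_grade[OF homogeneous]] dual_zero[OF homogeneous])
    then show ?case by (simp add: fun_eq_iff)
  qed
  then show ?thesis
    using dual.graded_module_axioms diff_dual_grade
    by (auto simp: is_dg_module_def total_dual graded_module_def graded_module_axioms_def
        k_linear_on_def diff_dual_add diff_dual_scale)
qed

subsection \<open>The cap product\<close>

lemma comult_rep: "comult_rep C c \<in> comult C c"
  and comult_diff: "p \<in> comult C c \<Longrightarrow> q \<in> comult C c \<Longrightarrow> p - q \<in> tensor_rel s s"
proof -
  interpret f: module "fscale :: 'k \<Rightarrow> ('a \<times> 'a \<Rightarrow>\<^sub>0 'k) \<Rightarrow> _" by (rule module_fscale)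
  have sub: "f.subspace (tensor_rel s s)" by (simp add: tensor_rel_def)
  have "comult C c \<in> tensor s s" using coalgebra by (simp add: is_dg_coalgebra_def)
  then obtain p0 where p0: "comult C c = {q. q - p0 \<in> tensor_rel s s}"
    by (auto simp: tensor_def tensor_class_def)
  then have "p0 \<in> comult C c" using f.subspace_0[OF sub] by simp
  then show "comult_rep C c \<in> comult C c" unfolding comult_rep_def by (rule someI)
  show "p \<in> comult C c \<Longrightarrow> q \<in> comult C c \<Longrightarrow> p - q \<in> tensor_rel s s"
    using f.subspace_diff[OF sub, of "p - p0" "q - p0"] p0 by simp
qed

lemma comult_add: "p \<in> comult C c \<Longrightarrow> p' \<in> comult C c' \<Longrightarrow> p + p' \<in> comult C (c + c')"
  using coalgebra unfolding is_dg_coalgebra_def by blast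

lemma comult_scale: "p \<in> comult C c \<Longrightarrow> fscale r p \<in> comult C (s r c)"
  using coalgebra unfolding is_dg_coalgebra_def by blast

lemma comult_grade: "c \<in> G n \<Longrightarrow> \<exists>p\<in>comult C c. p \<in> tensor_grade C n"
  using coalgebra unfolding is_dg_coalgebra_def by blast

lemma comult_tensor_diff: "p \<in> comult C c \<Longrightarrow> tensor_diff C p \<in> comult C (d c)"
  using coalgebra unfolding is_dg_coalgebra_def by blast

lemma coassoc:
  "p \<in> comult C c \<Longrightarrow> comult_left C p - comult_right C p \<in> tensor3_rel s"
  using coalgebra unfolding is_dg_coalgebra_def by blast

text \<open>Lets the representative picked by \<open>SOME\<close> be exchanged for one that suits
  the situation: a sum, a multiple, a homogeneous one, one given by \<open>tensor_diff\<close>, or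
  one transported along a morphism.\<close>

lemma lin_ext_comult_cong:
  assumes b: "bilinear_map s s u b" and p: "p \<in> comult C c" and q: "q \<in> comult C c"
  shows "lin_ext u (\<lambda>(x, y). b x y) p = lin_ext u (\<lambda>(x, y). b x y) q"
proof -
  have "module u" using b by (auto simp: bilinear_map_def module_hom_def)
  then show ?thesis
    using lin_ext_tensor_rel[OF b comult_diff[OF p q]] by (simp add: lin_ext_diff)
qed

lemma lin_ext_comult_hom:
  assumes b: "bilinear_map s s u b"
  shows "module_hom s u (\<lambda>c. lin_ext u (\<lambda>(x, y). b x y) (comult_rep C c))"
proof -
  have u: "module u" using b by (auto simp: bilinear_map_def module_hom_def)
  show ?thesis
    unfolding module_hom_iff
  proof (intro conjI allI)
    fix c c' r
    show "lin_ext u (\<lambda>(x, y). b x y) (comult_rep C (c + c')) =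
        lin_ext u (\<lambda>(x, y). b x y) (comult_rep C c) + lin_ext u (\<lambda>(x, y). b x y) (comult_rep C c')"
      using lin_ext_comult_cong[OF b comult_rep comult_add[OF comult_rep comult_rep]]
      by (simp add: lin_ext_add[OF u])
    show "lin_ext u (\<lambda>(x, y). b x y) (comult_rep C (s r c)) =
        u r (lin_ext u (\<lambda>(x, y). b x y) (comult_rep C c))"
      using lin_ext_comult_cong[OF b comult_rep comult_scale[OF comult_rep]]
      by (simp add: lin_ext_fscale[OF u])
  qed (use u module_axioms in auto)
qed

lemma tensor_grade_induct [consumes 1, case_names zero add scale gen]:
  assumes "p \<in> tensor_grade C n"
    and "P 0" and "\<And>p q. P p \<Longrightarrow> P q \<Longrightarrow> P (p + q)" and "\<And>r p. P p \<Longrightarrow> P (fscale r p)"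
    and "\<And>x y i. x \<in> G i \<Longrightarrow> y \<in> G (n - i) \<Longrightarrow> P (gen (x, y))"
  shows "P p"
  using assms(1) unfolding tensor_grade_def
proof (induction rule: span_fscale_induct)
  case (base p)
  then obtain x y i j where "p = gen (x, y)" "x \<in> G i" "y \<in> G j" "i + j = n" by blast
  moreover from this have "j = n - i" by simp
  ultimately show ?case using assms(5) by simp
qed (use assms in auto)

lemma lin_ext_tensor_grade_cong:
  assumes u: "module u" and p: "p \<in> tensor_grade C n"
    and eq: "\<And>x y i. x \<in> G i \<Longrightarrow> y \<in> G (n - i) \<Longrightarrow> g x y = h x y"
  shows "lin_ext u (\<lambda>(x, y). g x y) p = lin_ext u (\<lambda>(x, y). h x y) p"
  using p by (induction rule: tensor_grade_induct)
    (simp_all add: lin_ext_add[OF u] lin_ext_fscale[OF u] lin_ext_zero[OF u] lin_ext_gen[OF u] eq)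

text \<open>The cap product without its sign.\<close>

definition contract :: "('a \<Rightarrow> 'k) \<Rightarrow> 'a \<Rightarrow> 'a" where
  "contract \<phi> c = lin_ext s (\<lambda>(x, y). s (\<phi> x) y) (comult_rep C c)"

lemma bilinear_scale:
  assumes "module_hom s (*) \<phi>" "module_hom s s h"
  shows "bilinear_map s s s (\<lambda>x y. s (\<phi> x) (h y))"
  using assms module_axioms
  by (auto simp: bilinear_map_def module_hom_iff algebra_simps)

lemma bilinear_contract: "module_hom s (*) \<phi> \<Longrightarrow> bilinear_map s s s (\<lambda>x y. s (\<phi> x) y)"
  by (rule bilinear_scale[OF _ module_hom_ident])

lemma contract_eq:
  "module_hom s (*) \<phi> \<Longrightarrow> p \<in> comult C c \<Longrightarrow> contract \<phi> c = lin_ext s (\<lambda>(x, y). s (\<phi> x) y) p"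
  unfolding contract_def by (rule lin_ext_comult_cong[OF bilinear_contract comult_rep])

lemma contract_hom: "module_hom s (*) \<phi> \<Longrightarrow> module_hom s s (contract \<phi>)"
  unfolding contract_def[abs_def] by (rule lin_ext_comult_hom[OF bilinear_contract])

lemma contract_fun_scale: "contract (s_dual r \<phi>) c = s r (contract \<phi> c)"
  using lin_ext_fun_scale[OF module_axioms, of r "\<lambda>(x, y). s (\<phi> x) y"]
  by (simp add: contract_def case_prod_unfold)

text \<open>In a homogeneous representative only terms with first factor of degree
  \<open>- m\<close> survive, and their second factor then has degree \<open>n + m\<close>.\<close>

lemma contract_grade:
  assumes c: "c \<in> G n" and \<phi>: "\<phi> \<in> H m"
  shows "contract \<phi> c \<in> G (n + m)"
proof -
  obtain p where p: "p \<in> comult C c" "p \<in> tensor_grade C n" using comult_grade[OF c] by blast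
  note lin = lin_ext_add[OF module_axioms] lin_ext_fscale[OF module_axioms]
    lin_ext_zero[OF module_axioms] lin_ext_gen[OF module_axioms]
  have "lin_ext s (\<lambda>(x, y). s (\<phi> x) y) p \<in> G (n + m)"
    using p(2)
  proof (induction rule: tensor_grade_induct)
    case (gen x y i)
    show ?case
    proof (cases "i + m = 0")
      case True
      then have "n - i = n + m" by simp
      then have "y \<in> G (n + m)" using gen by metis
      then show ?thesis using subspace_grade by (simp add: lin subspace_scale)
    next
      case False
      then show ?thesis
        using dual_vanish[OF \<phi> gen(1)] subspace_grade by (simp add: lin subspace_0)
    qed
  qed (use subspace_grade in \<open>simp_all add: lin subspace_0 subspace_add subspace_scale\<close>)
  then show ?thesis using contract_eq[OF dual_hom[OF \<phi>] p(1)] by simp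
qed

text \<open>Contracting \<open>tensor_diff\<close> of a representative gives \<phi>(dx) y plus a
  signed \<phi>(x) dy. The sign depends on the degree of \<open>x\<close>, but \<phi> picks out
  degree \<open>- m\<close>, so it is constantly \<open>sgn_pow m\<close>.\<close>

lemma contract_leibniz:
  assumes \<phi>: "\<phi> \<in> H m"
  shows "contract \<phi> (d c) =
    contract (\<lambda>x. \<phi> (d x)) c + s (sgn_pow m) (d (contract \<phi> c))"
proof -
  let ?p = "comult_rep C c"
  note lin = lin_ext_add[OF module_axioms] lin_ext_fscale[OF module_axioms]
    lin_ext_sum[OF module_axioms] lin_ext_gen[OF module_axioms]
  have sgn: "sgn_pow (- m) = (sgn_pow m :: 'k)" by (simp add: sgn_pow_def)
  have "contract \<phi> (d c) = lin_ext s (\<lambda>(x, y). s (\<phi> x) y) (tensor_diff C ?p)"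
    by (rule contract_eq[OF dual_hom[OF \<phi>] comult_tensor_diff[OF comult_rep]])
  also have "\<dots> = lin_ext s (\<lambda>(x, y). s (\<phi> (d x)) y +
      (\<Sum>i\<in>degrees G x. s (sgn_pow i * \<phi> (component G i x)) (d y))) ?p"
    unfolding tensor_diff_def lin_ext_lin_ext[OF module_axioms]
    by (simp add: case_prod_unfold lin)
  also have "\<dots> = lin_ext s (\<lambda>(x, y). s (\<phi> (d x)) y + s (sgn_pow m) (d (s (\<phi> x) y))) ?p"
    by (simp add: scale_sum_left[symmetric] sum_degrees_dual[OF \<phi>] sgn diff_scale)
  also have "\<dots> = contract (\<lambda>x. \<phi> (d x)) c +
      s (sgn_pow m) (lin_ext s (\<lambda>(x, y). d (s (\<phi> x) y)) ?p)"
    by (simp add: contract_def case_prod_unfold lin_ext_fun_add[OF module_axioms]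
        lin_ext_fun_scale[OF module_axioms] del: scale_scale)
  also have "lin_ext s (\<lambda>(x, y). d (s (\<phi> x) y)) ?p = d (contract \<phi> c)"
    by (simp add: contract_def lin_ext_hom[OF module_hom_diff] case_prod_unfold)
  finally show ?thesis .
qed

section \<open>Collecting the signs of the evaluation and of the interchange\<close>

lemma ev_zero: "ev C x 0 = 0"
  using dual.degrees_homogeneous[OF dual.subspace_0[OF dual.subspace_grade[of 0]]]
  by (simp add: ev_def lin_ext_twist[OF module_mult])

text \<open>Only the component of degree \<open>- m\<close> contributes, and the exponent
  \<open>- m * m\<close> has the parity of \<open>m\<close>.\<close>

lemma ev_homogeneous:
  assumes \<phi>: "\<phi> \<in> H m"
  shows "ev C x \<phi> = sgn_pow m * \<phi> x"
proof -
  have "ev C x \<phi> = (\<Sum>i\<in>degrees G x. \<Sum>j\<in>degrees H \<phi>.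
      sgn_pow (i * j) * component H j \<phi> (component G i x))"
    by (simp add: ev_def lin_ext_twist[OF module_mult])
  also have "\<dots> = (\<Sum>i\<in>degrees G x. sgn_pow (i * m) * \<phi> (component G i x))"
    using dual.sum_degrees_homogeneous[OF \<phi>, of "\<lambda>j \<psi>. sgn_pow (i * j) * \<psi> (component G i x)" for i]
    by simp
  also have "\<dots> = sgn_pow m * \<phi> x"
    using sum_degrees_dual[OF \<phi>, of "\<lambda>i. sgn_pow (i * m)"]
    by (simp add: sgn_pow_def)
  finally show ?thesis .
qed

text \<open>The sign of the interchange with a form of degree \<open>m\<close>, packaged as a linear
  map of the second factor. This keeps the cap product the extension of a bilinear map even before
  \<open>c\<close> is assumed homogeneous.\<close>

definition twisted :: "int \<Rightarrow> 'a \<Rightarrow> 'a" where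
  "twisted m y = (\<Sum>i\<in>degrees G y. s (sgn_pow (i * m)) (component G i y))"

lemma twisted_homogeneous: "y \<in> G i \<Longrightarrow> twisted m y = s (sgn_pow (i * m)) y"
  unfolding twisted_def
  using sum_degrees_homogeneous[of y i "\<lambda>i y. s (sgn_pow (i * m)) y"] by simp

lemma twisted_hom: "module_hom s s (twisted m)"
proof -
  have "twisted m (x + y) = twisted m x + twisted m y" for x y
    unfolding twisted_def
    by (rule sum_degrees_add) (simp_all add: scale_right_distrib)
  moreover have "twisted m (s r x) = s r (twisted m x)" for r x
    unfolding twisted_def
    by (rule sum_degrees_scale[OF module_axioms]) (simp_all add: mult.commute)
  ultimately show ?thesis using module_axioms by (simp add: module_hom_iff)
qed

text \<open>Putting the sum over the degrees of \<phi> outermost gives the shape to which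
  \<open>sum_degrees_add\<close> and \<open>sum_degrees_scale\<close> apply.\<close>

lemma cap_expand:
  "cap C c \<phi> = lin_ext s (\<lambda>(x, y).
    \<Sum>j\<in>degrees H \<phi>. s (ev C x (component H j \<phi>)) (twisted j y)) (comult_rep C c)"
  unfolding cap_def lin_ext_twist[OF module_axioms] twisted_def
  by (intro arg_cong[where f = "\<lambda>g. lin_ext s g (comult_rep C c)"] ext)
    (auto simp: scale_sum_right mult.commute sum.swap[of _ "degrees G _" "degrees H \<phi>"])

text \<open>The intermediate form with \<open>c\<close> arbitrary, from which linearity in
  \<open>c\<close> is read off.\<close>

lemma cap_homogeneous':
  assumes "\<phi> \<in> H m"
  shows "cap C c \<phi> = lin_ext s (\<lambda>(x, y). s (sgn_pow m * \<phi> x) (twisted m y)) (comult_rep C c)"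
  using dual.sum_degrees_homogeneous[OF assms, of "\<lambda>j \<psi>. s (ev C x \<psi>) (twisted j y)" for x y]
  by (simp add: cap_expand ev_homogeneous[OF assms] ev_zero)

text \<open>On the terms that survive, \<open>x\<close> has degree \<open>- m\<close> and
  \<open>y\<close> degree \<open>n + m\<close>. Evaluation contributes the exponent
  \<open>m\<close>, the interchange \<open>(n + m) * m\<close>; since \<open>m + m * m\<close> is
  even, \<open>n * m\<close> remains.\<close>

lemma cap_homogeneous:
  assumes c: "c \<in> G n" and \<phi>: "\<phi> \<in> H m"
  shows "cap C c \<phi> = s (sgn_pow (n * m)) (contract \<phi> c)"
proof -
  obtain p where p: "p \<in> comult C c" "p \<in> tensor_grade C n" using comult_grade[OF c] by blast
  have hom: "module_hom s (*) (\<lambda>x. sgn_pow m * \<phi> x)"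
    by (rule module_pair.module_hom_scale[OF module_pair_mult dual_hom[OF \<phi>]])
  have "cap C c \<phi> = lin_ext s (\<lambda>(x, y). s (sgn_pow m * \<phi> x) (twisted m y)) p"
    unfolding cap_homogeneous'[OF \<phi>]
    by (rule lin_ext_comult_cong[OF bilinear_scale[OF hom twisted_hom] comult_rep p(1)])
  also have "\<dots> = lin_ext s (\<lambda>(x, y). s (sgn_pow (n * m)) (s (\<phi> x) y)) p"
  proof (rule lin_ext_tensor_grade_cong[OF module_axioms p(2)])
    fix x y i assume x: "x \<in> G i" and y: "y \<in> G (n - i)"
    show "s (sgn_pow m * \<phi> x) (twisted m y) = s (sgn_pow (n * m)) (s (\<phi> x) y)"
    proof (cases "i + m = 0")
      case True
      then have "i = - m" by simp
      then have "sgn_pow m * sgn_pow ((n - i) * m) = (sgn_pow (n * m) :: 'k)"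
        unfolding sgn_pow_mult by (intro sgn_pow_cong) auto
      moreover have "s (sgn_pow m * \<phi> x) (twisted m y) =
          s (sgn_pow m * sgn_pow ((n - i) * m)) (s (\<phi> x) y)"
        unfolding twisted_homogeneous[OF y] by (simp add: ac_simps)
      ultimately show ?thesis by simp
    qed (use dual_vanish[OF \<phi> x] in simp)
  qed
  also have "\<dots> = s (sgn_pow (n * m)) (contract \<phi> c)"
    using lin_ext_fun_scale[OF module_axioms, of "sgn_pow (n * m)" "\<lambda>(x, y). s (\<phi> x) y" p]
      contract_eq[OF dual_hom[OF \<phi>] p(1)]
    by (simp add: case_prod_unfold)
  finally show ?thesis .
qed

section \<open>Linearity of the cap product and its behaviour under the differentials\<close>

lemma cap_add:
  assumes "\<phi> \<in> dual.carrier" "\<psi> \<in> dual.carrier"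
  shows "cap C c (\<phi> + \<psi>) = cap C c \<phi> + cap C c \<psi>"
proof -
  have "(\<Sum>j\<in>degrees H (\<phi> + \<psi>). s (ev C x (component H j (\<phi> + \<psi>))) (twisted j y)) =
      (\<Sum>j\<in>degrees H \<phi>. s (ev C x (component H j \<phi>)) (twisted j y)) +
      (\<Sum>j\<in>degrees H \<psi>. s (ev C x (component H j \<psi>)) (twisted j y))" for x y
  proof (rule dual.sum_degrees_add[OF _ assms])
    fix i \<phi> \<psi> assume h: "\<phi> \<in> H i" "\<psi> \<in> H i"
    then have "\<phi> + \<psi> \<in> H i" using dual.subspace_grade dual.subspace_add by blast
    then show "s (ev C x (\<phi> + \<psi>)) (twisted i y) =
        s (ev C x \<phi>) (twisted i y) + s (ev C x \<psi>) (twisted i y)"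
      using h by (simp add: ev_homogeneous[of _ i] algebra_simps)
  qed
  then show ?thesis
    by (simp add: cap_expand lin_ext_fun_add[OF module_axioms, symmetric] case_prod_unfold)
qed

lemma cap_scale:
  assumes "\<phi> \<in> dual.carrier"
  shows "cap C c (s_dual r \<phi>) = s r (cap C c \<phi>)"
proof -
  have "(\<Sum>j\<in>degrees H (s_dual r \<phi>). s (ev C x (component H j (s_dual r \<phi>))) (twisted j y)) =
      s r (\<Sum>j\<in>degrees H \<phi>. s (ev C x (component H j \<phi>)) (twisted j y))" for x y
  proof (rule dual.sum_degrees_scale[OF module_axioms _ _ assms])
    fix i \<phi> assume h: "\<phi> \<in> H i"
    then have "s_dual r \<phi> \<in> H i" using dual.subspace_grade dual.subspace_scale by blast
    then show "s (ev C x (s_dual r \<phi>)) (twisted i y) = s r (s (ev C x \<phi>) (twisted i y))"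
      using h by (simp add: ev_homogeneous[of _ i] ac_simps)
  next
    show "s (ev C x 0) (twisted i y) = 0" for i by (simp add: ev_zero)
  qed
  then show ?thesis
    by (simp add: cap_expand lin_ext_fun_scale[OF module_axioms, symmetric] case_prod_unfold)
qed

lemma cap_zero: "cap C c 0 = 0"
  using cap_add[of 0 0 c] dual.span_zero by simp

text \<open>Linearity in the coalgebra argument is what later turns the boundary
  \<open>d - f c\<close> into a comparison of two cap products.\<close>

lemma cap_hom:
  assumes "\<phi> \<in> dual.carrier"
  shows "module_hom s s (\<lambda>c. cap C c \<phi>)"
  using assms
proof (induction rule: dual.carrier_induct)
  case zero
  show "module_hom s s (\<lambda>c. cap C c 0)"
    using module_axioms by (simp add: cap_zero module_hom_iff)
next
  case (add \<phi> \<psi>)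
  then show "module_hom s s (\<lambda>c. cap C c (\<phi> + \<psi>))"
    using module_axioms by (simp add: cap_add module_hom_iff algebra_simps)
next
  case (homogeneous m \<phi>)
  have hom: "module_hom s (*) (\<lambda>x. sgn_pow m * \<phi> x)"
    by (rule module_pair.module_hom_scale[OF module_pair_mult dual_hom[OF homogeneous]])
  show ?case
    unfolding cap_homogeneous'[OF homogeneous]
    by (rule lin_ext_comult_hom[OF bilinear_scale[OF hom twisted_hom]])
qed

lemma cap_grade: "c \<in> G n \<Longrightarrow> \<phi> \<in> H m \<Longrightarrow> cap C c \<phi> \<in> G (n + m)"
  using contract_grade subspace_grade by (simp add: cap_homogeneous subspace_scale)

text \<open>For a cycle \<open>c\<close> the Leibniz rule has a vanishing left side, and solving it
  for \<open>d (contract \<phi> c)\<close> produces the contraction with exactly the dual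
  differential of \<phi>. The outer signs match because
  \<open>n + n * (m - 1) = n * m\<close>.\<close>

lemma cap_diff_dual:
  assumes c: "c \<in> cycles C n" and \<phi>: "\<phi> \<in> dual.carrier"
  shows "d (cap C c \<phi>) = s (sgn_pow n) (cap C c (diff (dual C) \<phi>))"
  using \<phi>
proof (induction rule: dual.carrier_induct)
  case zero
  show "d (cap C c 0) = s (sgn_pow n) (cap C c (diff (dual C) 0))"
    by (simp add: diff_dual_zero cap_zero diff_zero)
next
  case (add \<phi> \<psi>)
  then show "d (cap C c (\<phi> + \<psi>)) = s (sgn_pow n) (cap C c (diff (dual C) (\<phi> + \<psi>)))"
    by (simp add: cap_add diff_dual_add diff_dual_carrier diff_add algebra_simps)
next
  case (homogeneous m \<phi>)
  have c': "c \<in> G n" "d c = 0" using c by (auto simp: cycles_def)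
  have "contract \<phi> (d c) = 0"
    using c' module_hom.zero[OF contract_hom[OF dual_hom[OF homogeneous]]] by simp
  then have eq: "s (sgn_pow m) (d (contract \<phi> c)) = - contract (\<lambda>x. \<phi> (d x)) c"
    using contract_leibniz[OF homogeneous, of c] by (simp add: eq_neg_iff_add_eq_0 add.commute)
  have "d (contract \<phi> c) = s (sgn_pow m * sgn_pow m) (d (contract \<phi> c))" by simp
  also have "\<dots> = s (- sgn_pow m) (contract (\<lambda>x. \<phi> (d x)) c)"
    using arg_cong[OF eq, of "s (sgn_pow m)"] by simp
  finally have contr: "d (contract \<phi> c) = s (- sgn_pow m) (contract (\<lambda>x. \<phi> (d x)) c)" .
  have dual: "diff (dual C) \<phi> = s_dual (- sgn_pow m) (\<lambda>x. \<phi> (d x))"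
    using diff_dual_homogeneous[OF homogeneous] by (simp add: fun_eq_iff)
  have "s (sgn_pow n) (cap C c (diff (dual C) \<phi>)) =
      s (sgn_pow n * sgn_pow (n * (m - 1))) (contract (diff (dual C) \<phi>) c)"
    using cap_homogeneous[OF c'(1) diff_dual_grade[OF homogeneous]] by simp
  also have "sgn_pow n * sgn_pow (n * (m - 1)) = (sgn_pow (n * m) :: 'k)"
    unfolding sgn_pow_mult by (intro sgn_pow_cong) (auto simp: algebra_simps)
  also have "contract (diff (dual C) \<phi>) c = d (contract \<phi> c)"
    unfolding dual contract_fun_scale contr ..
  finally show ?case
    using cap_homogeneous[OF c'(1) homogeneous] by (simp add: diff_scale)
qed

lemma dg_map_cap:
  assumes c: "c \<in> cycles C n"
  shows "dg_map n (dual C) C (cap C c)"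
proof -
  have "c \<in> G n" using c by (simp add: cycles_def)
  then show ?thesis
    using cap_grade[of c n]
    by (auto simp: dg_map_def total_dual k_linear_on_def cap_add cap_scale cap_diff_dual[OF c]
        add.commute)
qed

text \<open>The convolution product without its sign.\<close>

definition convolve :: "('a \<Rightarrow> 'k) \<Rightarrow> ('a \<Rightarrow> 'k) \<Rightarrow> 'a \<Rightarrow> 'k" where
  "convolve \<phi> \<psi> c = lin_ext (*) (\<lambda>(x, y). \<phi> x * \<psi> y) (comult_rep C c)"

lemma bilinear_convolve:
  assumes "module_hom s (*) \<phi>" "module_hom s (*) \<psi>"
  shows "bilinear_map s s (*) (\<lambda>x y. \<phi> x * \<psi> y)"
  using assms by (auto simp: bilinear_map_def module_hom_iff algebra_simps)

lemma convolve_grade: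
  assumes \<phi>: "\<phi> \<in> H i" and \<psi>: "\<psi> \<in> H j"
  shows "convolve \<phi> \<psi> \<in> H (i + j)"
proof (rule dual_gradeI)
  note b = bilinear_convolve[OF dual_hom[OF \<phi>] dual_hom[OF \<psi>]]
  show "module_hom s (*) (convolve \<phi> \<psi>)"
    unfolding convolve_def[abs_def] by (rule lin_ext_comult_hom[OF b])
  fix l c assume c: "c \<in> G l" and l: "l + (i + j) \<noteq> 0"
  obtain p where p: "p \<in> comult C c" "p \<in> tensor_grade C l" using comult_grade[OF c] by blast
  have "convolve \<phi> \<psi> c = lin_ext (*) (\<lambda>(x, y). \<phi> x * \<psi> y) p"
    unfolding convolve_def by (rule lin_ext_comult_cong[OF b comult_rep p(1)])
  also have "\<dots> = lin_ext (*) (\<lambda>(x, y). 0) p"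
  proof (rule lin_ext_tensor_grade_cong[OF module_mult p(2)])
    fix x y k assume "x \<in> G k" "y \<in> G (l - k)"
    then show "\<phi> x * \<psi> y = 0"
      using dual_vanish[OF \<phi>, of x k] dual_vanish[OF \<psi>, of y "l - k"] l
      by (cases "k + i = 0") auto
  qed
  finally show "convolve \<phi> \<psi> c = 0" by (simp add: lin_ext_def)
qed

text \<open>Coassociativity tested against the trilinear map sending (x, y, z) to \<phi>(x)
  \<psi>(y) z: bracketing to the left gives the contraction with the convolution, bracketing to the
  right the iterated contraction.\<close>

lemma contract_convolve:
  assumes \<phi>: "module_hom s (*) \<phi>" and \<psi>: "module_hom s (*) \<psi>"
  shows "contract (convolve \<phi> \<psi>) c = contract \<psi> (contract \<phi> c)"
proof -
  let ?p = "comult_rep C c"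
  let ?T = "\<lambda>(x, y, z). s (\<phi> x * \<psi> y) z"
  note lin = lin_ext_lin_ext[OF module_axioms] lin_ext_gen[OF module_axioms]
  have scale_hom: "module_hom (*) s (\<lambda>r. s r y)" for y
    using module_axioms module_mult by (simp add: module_hom_iff algebra_simps)
  have "lin_ext s ?T (comult_left C ?p - comult_right C ?p) = 0"
    by (rule lin_ext_tensor3_rel[OF _ _ _ coassoc[OF comult_rep]])
      (use \<phi> \<psi> in \<open>simp_all add: module_hom_iff algebra_simps\<close>)
  then have "lin_ext s ?T (comult_left C ?p) = lin_ext s ?T (comult_right C ?p)"
    by (simp add: lin_ext_diff[OF module_axioms])
  moreover have "lin_ext s ?T (comult_left C ?p) = contract (convolve \<phi> \<psi>) c"
    by (simp add: comult_left_def lin case_prod_unfold contract_def convolve_def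
        lin_ext_hom[OF scale_hom])
  moreover have "contract \<psi> (s (\<phi> x) y) =
      lin_ext s (\<lambda>(y', y''). s (\<phi> x * \<psi> y') y'') (comult_rep C y)" for x y
    using lin_ext_fun_scale[OF module_axioms, of "\<phi> x" "\<lambda>(y', y''). s (\<psi> y') y''" "comult_rep C y"]
    unfolding module_hom.scale[OF contract_hom[OF \<psi>]] contract_def[of \<psi> y] by (simp add: case_prod_unfold)
  then have "lin_ext s ?T (comult_right C ?p) =
      lin_ext s (\<lambda>(x, y). contract \<psi> (s (\<phi> x) y)) ?p"
    by (simp add: comult_right_def lin case_prod_unfold)
  moreover have "\<dots> = contract \<psi> (contract \<phi> c)"
    by (simp add: contract_def[of \<phi>] lin_ext_hom[OF contract_hom[OF \<psi>]] case_prod_unfold)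
  ultimately show ?thesis by simp
qed

lemma dual_mult_expand:
  "dual_mult C \<phi> \<psi> c = lin_ext (*) (\<lambda>(x, y). \<Sum>j\<in>degrees H \<psi>.
      (\<Sum>i\<in>degrees G x. sgn_pow (i * j) * \<phi> (component G i x)) * component H j \<psi> y) (comult_rep C c)"
  unfolding dual_mult_def lin_ext_twist[OF module_mult]
  by (intro arg_cong[where f = "\<lambda>g. lin_ext (*) g (comult_rep C c)"] ext)
    (auto simp: sum_distrib_right mult.assoc sum.swap[of _ "degrees G _" "degrees H \<psi>"])

text \<open>The sign involves the degree of \<open>x\<close>, which \<phi> forces to be
  \<open>- i\<close>; the exponents \<open>- i * j\<close> and \<open>i * j\<close> have the same
  parity.\<close>

lemma dual_mult_homogeneous:
  assumes \<phi>: "\<phi> \<in> H i" and \<psi>: "\<psi> \<in> H j"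
  shows "dual_mult C \<phi> \<psi> = s_dual (sgn_pow (i * j)) (convolve \<phi> \<psi>)"
proof
  fix c
  have "(\<Sum>l\<in>degrees H \<psi>. (\<Sum>k\<in>degrees G x. sgn_pow (k * l) * \<phi> (component G k x)) *
      component H l \<psi> y) = sgn_pow (i * j) * (\<phi> x * \<psi> y)" for x y
  proof -
    have "(\<Sum>k\<in>degrees G x. sgn_pow (k * l) * \<phi> (component G k x)) = sgn_pow (- i * l) * \<phi> x" for l
      by (rule sum_degrees_dual[OF \<phi>])
    then have "(\<Sum>l\<in>degrees H \<psi>. (\<Sum>k\<in>degrees G x. sgn_pow (k * l) * \<phi> (component G k x)) *
        component H l \<psi> y) = (\<Sum>l\<in>degrees H \<psi>. sgn_pow (- i * l) * \<phi> x * component H l \<psi> y)"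
      by (simp only:)
    also have "\<dots> = sgn_pow (- i * j) * \<phi> x * \<psi> y"
      using dual.sum_degrees_homogeneous[OF \<psi>, of "\<lambda>l \<psi>. sgn_pow (- i * l) * \<phi> x * \<psi> y"] by simp
    finally show ?thesis by (simp add: sgn_pow_def)
  qed
  then have "dual_mult C \<phi> \<psi> c =
      lin_ext (*) (\<lambda>(x, y). sgn_pow (i * j) * (\<phi> x * \<psi> y)) (comult_rep C c)"
    by (simp only: dual_mult_expand)
  then show "dual_mult C \<phi> \<psi> c = sgn_pow (i * j) * convolve \<phi> \<psi> c"
    using lin_ext_fun_scale[OF module_mult, of "sgn_pow (i * j)" "\<lambda>(x, y). \<phi> x * \<psi> y"]
    by (simp only: convolve_def case_prod_unfold)
qed

lemma dual_mult_add_left: "dual_mult C (\<phi> + \<phi>') \<psi> = dual_mult C \<phi> \<psi> + dual_mult C \<phi>' \<psi>"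
  by (simp add: fun_eq_iff dual_mult_expand lin_ext_fun_add[OF module_mult, symmetric]
      case_prod_unfold algebra_simps sum.distrib)

lemma dual_mult_add_right:
  assumes "\<psi> \<in> dual.carrier" "\<psi>' \<in> dual.carrier"
  shows "dual_mult C \<phi> (\<psi> + \<psi>') = dual_mult C \<phi> \<psi> + dual_mult C \<phi> \<psi>'"
proof -
  have "(\<Sum>j\<in>degrees H (\<psi> + \<psi>'). a j * component H j (\<psi> + \<psi>') y) =
    (\<Sum>j\<in>degrees H \<psi>. a j * component H j \<psi> y) + (\<Sum>j\<in>degrees H \<psi>'. a j * component H j \<psi>' y)"
    for a y
    by (rule dual.sum_degrees_add[OF _ assms]) (simp add: algebra_simps)
  then show ?thesis
    by (simp add: fun_eq_iff dual_mult_expand lin_ext_fun_add[OF module_mult, symmetric]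
        case_prod_unfold)
qed

lemma dual_mult_homogeneous_grade:
  "\<phi> \<in> H i \<Longrightarrow> \<psi> \<in> H j \<Longrightarrow> dual_mult C \<phi> \<psi> \<in> H (i + j)"
  using dual.subspace_scale[OF subspace_dual_grade convolve_grade]
  by (simp add: dual_mult_homogeneous)

text \<open>Both sides carry the exponent \<open>n * i + n * j + i * j\<close>; what remains is the
  unsigned law \<open>contract_convolve\<close>.\<close>

lemma cap_dual_mult_homogeneous:
  assumes c: "c \<in> G n" and \<phi>: "\<phi> \<in> H i" and \<psi>: "\<psi> \<in> H j"
  shows "cap C c (dual_mult C \<phi> \<psi>) = cap C (cap C c \<phi>) \<psi>"
proof -
  have "cap C c (dual_mult C \<phi> \<psi>) =
      s (sgn_pow (n * (i + j)) * sgn_pow (i * j)) (contract \<psi> (contract \<phi> c))"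
    unfolding cap_homogeneous[OF c dual_mult_homogeneous_grade[OF \<phi> \<psi>]]
    by (simp add: dual_mult_homogeneous[OF \<phi> \<psi>] contract_fun_scale
        contract_convolve[OF dual_hom[OF \<phi>] dual_hom[OF \<psi>]])
  moreover have "cap C (cap C c \<phi>) \<psi> =
      s (sgn_pow ((n + i) * j) * sgn_pow (n * i)) (contract \<psi> (contract \<phi> c))"
    unfolding cap_homogeneous[OF cap_grade[OF c \<phi>] \<psi>]
    by (simp add: cap_homogeneous[OF c \<phi>] module_hom.scale[OF contract_hom[OF dual_hom[OF \<psi>]]])
  moreover have "sgn_pow (n * (i + j)) * sgn_pow (i * j) =
      (sgn_pow ((n + i) * j) * sgn_pow (n * i) :: 'k)"
    unfolding sgn_pow_mult by (simp add: algebra_simps)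
  ultimately show ?thesis by simp
qed

text \<open>Membership of the product in the carrier is carried through both inductions because
  \<open>cap_add\<close> asks for it when the product is split.\<close>

lemma cap_dual_mult:
  assumes c: "c \<in> G n" and \<phi>: "\<phi> \<in> dual.carrier" and \<psi>: "\<psi> \<in> dual.carrier"
  shows "dual_mult C \<phi> \<psi> \<in> dual.carrier \<and> cap C c (dual_mult C \<phi> \<psi>) = cap C (cap C c \<phi>) \<psi>"
  using \<phi>
proof (induction rule: dual.carrier_induct)
  case zero
  have "dual_mult C 0 \<psi> = 0" using dual_mult_add_left[of 0 0] by simp
  then show "dual_mult C 0 \<psi> \<in> dual.carrier \<and> cap C c (dual_mult C 0 \<psi>) = cap C (cap C c 0) \<psi>"
    using module_hom.zero[OF cap_hom[OF \<psi>]] by (simp add: cap_zero dual.span_zero)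
next
  case (add \<phi> \<phi>')
  then show "dual_mult C (\<phi> + \<phi>') \<psi> \<in> dual.carrier \<and>
      cap C c (dual_mult C (\<phi> + \<phi>') \<psi>) = cap C (cap C c (\<phi> + \<phi>')) \<psi>"
    using module_hom.add[OF cap_hom[OF \<psi>]]
    by (simp add: dual_mult_add_left cap_add dual.span_add)
next
  case (homogeneous i \<phi>)
  show ?case
    using \<psi>
  proof (induction rule: dual.carrier_induct)
    case zero
    have "dual_mult C \<phi> 0 = 0"
      using dual_mult_add_right[OF dual.span_zero dual.span_zero, of \<phi>] by simp
    then show "dual_mult C \<phi> 0 \<in> dual.carrier \<and> cap C c (dual_mult C \<phi> 0) = cap C (cap C c \<phi>) 0"
      by (simp add: cap_zero dual.span_zero)
  next
    case (add \<psi> \<psi>')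
    then show "dual_mult C \<phi> (\<psi> + \<psi>') \<in> dual.carrier \<and>
        cap C c (dual_mult C \<phi> (\<psi> + \<psi>')) = cap C (cap C c \<phi>) (\<psi> + \<psi>')"
      by (simp add: dual_mult_add_right cap_add dual.span_add)
  next
    case (homogeneous j \<psi>)
    then show ?case
      using cap_dual_mult_homogeneous[OF c \<open>\<phi> \<in> H i\<close> homogeneous]
        dual.grade_subset_carrier[OF dual_mult_homogeneous_grade[OF \<open>\<phi> \<in> H i\<close> homogeneous]]
      by simp
  qed
qed

lemma dual_module_hom_cap: "c \<in> cycles C n \<Longrightarrow> dual_module_hom n C (cap C c)"
  using dg_map_cap cap_dual_mult[of c n] by (simp add: dual_module_hom_def total_dual cycles_def)

end

subsection \<open>Homology\<close>

text \<open>Passes from classes to representatives, so that homology can afterwards be treated with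
  cycles modulo boundaries only.\<close>

lemma bij_betw_quotient_iff:
  assumes R: "equiv A R" and Q: "equiv B Q" and g: "\<And>x y. (x, y) \<in> R \<Longrightarrow> (g x, g y) \<in> Q"
  shows "bij_betw (\<lambda>X. \<Union>x\<in>X. Q `` {g x}) (A // R) (B // Q) \<longleftrightarrow>
    (\<forall>x\<in>A. \<forall>y\<in>A. (g x, g y) \<in> Q \<longrightarrow> (x, y) \<in> R) \<and> (\<forall>z\<in>B. \<exists>x\<in>A. (z, g x) \<in> Q)"
    (is "?L \<longleftrightarrow> ?inj \<and> ?sur")
proof -
  let ?h = "\<lambda>X. \<Union>x\<in>X. Q `` {g x}"
  have gB: "g x \<in> B" if "x \<in> A" for x
    using g[of x x] that by (simp add: equiv_class_eq_iff[OF R] equiv_class_eq_iff[OF Q])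
  have class_eq: "Q `` {g x} = Q `` {g y} \<longleftrightarrow> (g x, g y) \<in> Q" if "x \<in> A" "y \<in> A" for x y
    using eq_equiv_class_iff[OF Q] gB that by blast
  have h: "?h (R `` {x}) = Q `` {g x}" if "x \<in> A" for x
    using that equiv_class_eq[OF Q g] by (intro UN_equiv_class[OF R]) (auto simp only: congruent_def)
  have "inj_on ?h (A // R) \<longleftrightarrow> ?inj"
  proof
    assume inj: "inj_on ?h (A // R)"
    show ?inj
    proof (intro ballI impI)
      fix x y assume xy: "x \<in> A" "y \<in> A" "(g x, g y) \<in> Q"
      then have "?h (R `` {x}) = ?h (R `` {y})" by (simp only: h class_eq)
      then have "R `` {x} = R `` {y}"
        by (rule inj_onD[OF inj _ quotientI[OF xy(1)] quotientI[OF xy(2)]])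
      then show "(x, y) \<in> R" using eq_equiv_class_iff[OF R xy(1,2)] by simp
    qed
  next
    assume inj: ?inj
    show "inj_on ?h (A // R)"
    proof (rule inj_onI)
      fix X Y assume X: "X \<in> A // R" and Y: "Y \<in> A // R" and eq: "?h X = ?h Y"
      obtain x where x: "x \<in> A" "X = R `` {x}" using X by (rule quotientE)
      obtain y where y: "y \<in> A" "Y = R `` {y}" using Y by (rule quotientE)
      have "(g x, g y) \<in> Q" using eq x y by (simp only: h class_eq)
      then show "X = Y" using inj x y equiv_class_eq[OF R] by simp
    qed
  qed
  moreover have "?h ` (A // R) = (\<lambda>x. Q `` {g x}) ` A"
  proof (intro equalityI subsetI)
    fix Z assume "Z \<in> ?h ` (A // R)"
    then obtain X where "X \<in> A // R" "Z = ?h X" by blast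
    moreover from this obtain x where "x \<in> A" "X = R `` {x}" by (elim quotientE)
    ultimately show "Z \<in> (\<lambda>x. Q `` {g x}) ` A" using h by blast
  next
    fix Z assume "Z \<in> (\<lambda>x. Q `` {g x}) ` A"
    then obtain x where x: "x \<in> A" "Z = Q `` {g x}" by blast
    show "Z \<in> ?h ` (A // R)"
      by (rule image_eqI[OF _ quotientI[OF x(1)]]) (simp only: h[OF x(1)] x(2))
  qed
  moreover have "(\<lambda>x. Q `` {g x}) ` A = B // Q \<longleftrightarrow> ?sur"
  proof
    assume eq: "(\<lambda>x. Q `` {g x}) ` A = B // Q"
    show ?sur
    proof
      fix z assume z: "z \<in> B"
      then have "Q `` {z} \<in> (\<lambda>x. Q `` {g x}) ` A" using eq by (simp add: quotientI)
      then obtain x where "x \<in> A" "Q `` {z} = Q `` {g x}" by blast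
      then show "\<exists>x\<in>A. (z, g x) \<in> Q" using eq_equiv_class_iff[OF Q z gB] by blast
    qed
  next
    assume sur: ?sur
    show "(\<lambda>x. Q `` {g x}) ` A = B // Q"
    proof (intro equalityI subsetI)
      fix Z assume "Z \<in> B // Q"
      then obtain z where z: "z \<in> B" "Z = Q `` {z}" by (rule quotientE)
      then obtain x where "x \<in> A" "(z, g x) \<in> Q" using sur by blast
      then show "Z \<in> (\<lambda>x. Q `` {g x}) ` A" using z equiv_class_eq[OF Q] by blast
    next
      fix Z assume "Z \<in> (\<lambda>x. Q `` {g x}) ` A"
      then obtain x where x: "x \<in> A" "Z = Q `` {g x}" by blast
      show "Z \<in> B // Q" unfolding x(2) by (rule quotientI[OF gB[OF x(1)]])
    qed
  qed
  ultimately show ?thesis by (simp only: bij_betw_def)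
qed

locale dg_mod =
  fixes M :: "('k::comm_ring_1, 'a::ab_group_add, 'z) dg_module_scheme"
  assumes M: "is_dg_module M"
begin

sublocale graded_module "scale M" "grade M"
  by (rule dg_module_graded[OF M])

lemma grade_total: "x \<in> grade M n \<Longrightarrow> x \<in> total M"
  by (simp add: total_def grade_subset_carrier)

lemma diff_additive: "x \<in> total M \<Longrightarrow> y \<in> total M \<Longrightarrow> diff M (x + y) = diff M x + diff M y"
  and diff_scale: "x \<in> total M \<Longrightarrow> diff M (scale M r x) = scale M r (diff M x)"
  using M by (auto simp: is_dg_module_def k_linear_on_def)

lemma diff_zero: "diff M 0 = 0"
  using diff_additive[of 0 0] by (simp add: total_def span_zero)

lemma subspace_cycles: "subspace (cycles M n)"
  using subspace_grade[of n] grade_total[of _ n]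
  by (auto simp: cycles_def intro!: subspaceI
      simp: subspace_0 subspace_add subspace_scale diff_zero diff_additive diff_scale)

lemma subspace_boundaries: "subspace (boundaries M n)"
proof (rule subspaceI)
  have sub: "subspace (grade M (n + 1))" by (rule subspace_grade)
  show "0 \<in> boundaries M n"
    unfolding boundaries_def using subspace_0[OF sub] diff_zero by force
  show "x + y \<in> boundaries M n" if "x \<in> boundaries M n" "y \<in> boundaries M n" for x y
    using that subspace_add[OF sub] unfolding boundaries_def
    by (force simp: diff_additive[symmetric] grade_total)
  show "scale M r x \<in> boundaries M n" if "x \<in> boundaries M n" for x r
    using that subspace_scale[OF sub] unfolding boundaries_def
    by (force simp: diff_scale[symmetric] grade_total)
qed

lemma equiv_homologous: "equiv (cycles M n) (homologous M n)"
proof (rule equivI)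
  note b = subspace_boundaries[of n]
  show "homologous M n \<subseteq> cycles M n \<times> cycles M n" by (auto simp: homologous_def)
  show "refl_on (cycles M n) (homologous M n)"
    using subspace_0[OF b] by (auto simp: refl_on_def homologous_def)
  show "sym (homologous M n)"
    using subspace_neg[OF b] by (force simp: sym_def homologous_def)
  show "trans (homologous M n)"
    using subspace_add[OF b, of "x - y" "y - z" for x y z] by (auto simp: trans_def homologous_def)
qed

end

text \<open>Additivity on cycles reduces injectivity on classes to a trivial kernel. The three
  companion facts are stated here because they come out of the same computation.\<close>

lemma quasi_iso_iff:
  assumes M: "is_dg_module M" and N: "is_dg_module N" and g: "dg_map n M N g"
  shows "quasi_iso n M N g \<longleftrightarrow> (\<forall>m.
    (\<forall>x\<in>cycles M m. g x \<in> boundaries N (m + n) \<longrightarrow> x \<in> boundaries M m) \<and>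
    (\<forall>z\<in>cycles N (m + n). \<exists>x\<in>cycles M m. z - g x \<in> boundaries N (m + n)))"
    and dg_map_cycles: "x \<in> cycles M m \<Longrightarrow> g x \<in> cycles N (m + n)"
    and dg_map_boundaries: "x \<in> boundaries M m \<Longrightarrow> g x \<in> boundaries N (m + n)"
    and dg_map_cycles_diff: "x \<in> cycles M m \<Longrightarrow> y \<in> cycles M m \<Longrightarrow> g (x - y) = g x - g y"
proof -
  interpret M: dg_mod M by (rule dg_mod.intro[OF M])
  interpret N: dg_mod N by (rule dg_mod.intro[OF N])
  have g_add: "g (x + y) = g x + g y" if "x \<in> total M" "y \<in> total M" for x y
    using g that by (auto simp: dg_map_def k_linear_on_def)
  have g_scale: "g (scale M r x) = scale N r (g x)" if "x \<in> total M" for x r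
    using g that by (auto simp: dg_map_def k_linear_on_def)
  have g_grade: "g x \<in> grade N (m + n)" if "x \<in> grade M m" for x m
    using g that by (auto simp: dg_map_def)
  have g_diff: "diff N (g x) = scale N (sgn_pow n) (g (diff M x))" if "x \<in> total M" for x
    using g that by (auto simp: dg_map_def)
  have g_zero: "g 0 = 0" using g_add[of 0 0] by (simp add: total_def M.span_zero)
  show cyc: "g x \<in> cycles N (m + n)" if "x \<in> cycles M m" for x m
    using that g_grade[of x m] g_diff[of x] M.grade_total[of x m] by (auto simp: cycles_def g_zero)
  show bd: "g x \<in> boundaries N (m + n)" if x: "x \<in> boundaries M m" for x m
  proof -
    obtain y where y: "y \<in> grade M (m + 1)" "x = diff M y" using x unfolding boundaries_def by blast
    have yt: "y \<in> total M" by (rule M.grade_total[OF y(1)])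
    have gy: "g y \<in> grade N (m + n + 1)" using g_grade[OF y(1)] by (simp add: ac_simps)
    \<comment> \<open>A map of degree \<open>n\<close> commutes with the differentials up to
      \<open>sgn_pow n\<close>, so \<open>g y\<close> must be corrected by this sign, which is its
      own inverse.\<close>
    have "diff N (scale N (sgn_pow n) (g y)) = g x"
      using g_diff[OF yt] y(2) by (simp add: N.diff_scale[OF N.grade_total[OF gy]])
    moreover have "scale N (sgn_pow n) (g y) \<in> grade N (m + n + 1)"
      using gy N.subspace_grade by (simp add: N.subspace_scale)
    ultimately show ?thesis unfolding boundaries_def by (metis image_eqI)
  qed
  have cyc_total: "x \<in> total M" if "x \<in> cycles M m" for x m
    using that M.grade_total by (auto simp: cycles_def)
  show sub: "g (x - y) = g x - g y" if xy: "x \<in> cycles M m" "y \<in> cycles M m" for x y m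
  proof -
    have "x - y \<in> cycles M m" using M.subspace_diff[OF M.subspace_cycles] xy by blast
    then have "g (x - y + y) = g (x - y) + g y" using g_add cyc_total xy by blast
    then show ?thesis by (simp add: algebra_simps)
  qed
  have "bij_betw (homology_map N (m + n) g) (homology M m) (homology N (m + n)) \<longleftrightarrow>
    (\<forall>x\<in>cycles M m. g x \<in> boundaries N (m + n) \<longrightarrow> x \<in> boundaries M m) \<and>
    (\<forall>z\<in>cycles N (m + n). \<exists>x\<in>cycles M m. z - g x \<in> boundaries N (m + n))" for m
  proof -
    have resp: "(g x, g y) \<in> homologous N (m + n)" if "(x, y) \<in> homologous M m" for x y
      using that cyc bd[of "x - y" m] sub[of x m y] by (auto simp: homologous_def)
    have 0: "0 \<in> cycles M m" by (rule M.subspace_0[OF M.subspace_cycles])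
    have "(\<forall>x\<in>cycles M m. \<forall>y\<in>cycles M m. (g x, g y) \<in> homologous N (m + n) \<longrightarrow> (x, y) \<in> homologous M m)
      \<longleftrightarrow> (\<forall>x\<in>cycles M m. g x \<in> boundaries N (m + n) \<longrightarrow> x \<in> boundaries M m)" (is "?A \<longleftrightarrow> ?B")
    proof
      assume A: ?A
      show ?B
      proof (intro ballI impI)
        fix x assume "x \<in> cycles M m" "g x \<in> boundaries N (m + n)"
        then show "x \<in> boundaries M m"
          using A[rule_format, of x 0] 0 cyc[of x] cyc[OF 0] by (auto simp: homologous_def g_zero)
      qed
    next
      assume B: ?B
      show ?A
      proof (intro ballI impI)
        fix x y assume xy: "x \<in> cycles M m" "y \<in> cycles M m" "(g x, g y) \<in> homologous N (m + n)"
        then have "g (x - y) \<in> boundaries N (m + n)" by (simp add: homologous_def sub)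
        then show "(x, y) \<in> homologous M m"
          using B M.subspace_diff[OF M.subspace_cycles] xy by (auto simp: homologous_def)
      qed
    qed
    moreover have "(\<forall>z\<in>cycles N (m + n). \<exists>x\<in>cycles M m. (z, g x) \<in> homologous N (m + n)) \<longleftrightarrow>
      (\<forall>z\<in>cycles N (m + n). \<exists>x\<in>cycles M m. z - g x \<in> boundaries N (m + n))"
      using cyc by (auto simp: homologous_def)
    moreover have "homology_map N (m + n) g = (\<lambda>X. \<Union>x\<in>X. homologous N (m + n) `` {g x})"
      by (simp add: fun_eq_iff homology_map_def homology_class_def)
    ultimately show ?thesis
      using bij_betw_quotient_iff[OF M.equiv_homologous[of m] N.equiv_homologous[of "m + n"], of g] resp
      by (simp add: homology_def)
  qed
  then show "quasi_iso n M N g \<longleftrightarrow> (\<forall>m.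
    (\<forall>x\<in>cycles M m. g x \<in> boundaries N (m + n) \<longrightarrow> x \<in> boundaries M m) \<and>
    (\<forall>z\<in>cycles N (m + n). \<exists>x\<in>cycles M m. z - g x \<in> boundaries N (m + n)))"
    using g by (simp add: quasi_iso_def)
qed

subsection \<open>Duals of quasi-isomorphisms\<close>

text \<open>
  The section \<open>\<sigma>\<close> of \<open>del\<close> over the boundaries splits off the cycles of degree \<open>n - 1\<close>; on these
  \<open>\<psi> (del x) = \<phi> x\<close> is well defined, and \<open>\<psi>\<close> extends along the projection \<open>x \<mapsto> x - \<sigma> (del x)\<close>.
\<close>

lemma extend_cocycle:
  fixes s :: "'k::principal_ideal_domain \<Rightarrow> 'e::ab_group_add \<Rightarrow> 'e" and \<pi> :: "'i \<Rightarrow> 'e \<Rightarrow> 'k"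
    and E :: "int \<Rightarrow> 'e set"
  assumes \<pi>: "\<And>i. module_hom s (*) (\<pi> i)" "\<And>x. finite {i. \<pi> i x \<noteq> 0}"
      "\<And>x. (\<And>i. \<pi> i x = 0) \<Longrightarrow> x = 0"
    and del: "module_hom s s del" and del_del: "\<And>x. del (del x) = 0"
    and E: "\<And>k. module.subspace s (E k)" "\<And>k x. x \<in> E k \<Longrightarrow> del x \<in> E (k - 1)"
    and exact: "\<And>k x. x \<in> E k \<Longrightarrow> del x = 0 \<Longrightarrow> \<exists>y\<in>E (k + 1). x = del y"
    and \<phi>: "module_hom s (*) \<phi>" and cocycle: "\<And>x. x \<in> E (n + 1) \<Longrightarrow> \<phi> (del x) = 0"
  shows "\<exists>\<psi>. k_linear_on (E (n - 1)) s (*) \<psi> \<and> (\<forall>x\<in>E n. \<phi> x = \<psi> (del x))"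
proof -
  interpret s: module s using del by (simp add: module_hom_def)
  interpret del: module_hom s s del by (rule del)
  interpret \<phi>: module_hom s "(*)" \<phi> by (rule \<phi>)
  define P where "P = E (n - 1)"
  have P: "s.subspace P" unfolding P_def by (rule E)
  have "k_linear_on P s s del" by (simp add: k_linear_on_def del.add del.scale)
  then obtain \<sigma> where \<sigma>: "k_linear_on (del ` P) s s \<sigma>"
      and \<sigma>P: "\<And>x. x \<in> del ` P \<Longrightarrow> \<sigma> x \<in> P" and del_\<sigma>: "\<And>x. x \<in> del ` P \<Longrightarrow> del (\<sigma> x) = x"
    using split_over_submodule_of_free[OF s.module_axioms del.subspace_image[OF P] P _ order_refl \<pi>]
    by blast
  have \<sigma>_add: "\<sigma> (del x + del y) = \<sigma> (del x) + \<sigma> (del y)" if "x \<in> P" "y \<in> P" for x y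
    using \<sigma> that by (simp add: k_linear_on_def)
  have \<sigma>_scale: "\<sigma> (s r (del x)) = s r (\<sigma> (del x))" if "x \<in> P" for r x
    using \<sigma> that by (simp add: k_linear_on_def)
  \<comment> \<open>Elements with equal boundary differ by a cycle, hence by a boundary, and \<phi>
    vanishes on boundaries from degree \<open>n + 1\<close>.\<close>
  have wd: "\<phi> x = \<phi> y" if xy: "x \<in> E n" "y \<in> E n" "del x = del y" for x y
  proof -
    obtain z where "z \<in> E (n + 1)" "x - y = del z"
      using exact[of "x - y" n] xy s.subspace_diff[OF E(1)] by (auto simp: del.diff)
    then have "\<phi> (x - y) = 0" using cocycle by simp
    then show ?thesis by (simp add: \<phi>.diff)
  qed
  \<comment> \<open>The element \<open>x - \<sigma> (del x)\<close> is a cycle of degree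
    \<open>n - 1\<close>, so exactness supplies a preimage of degree \<open>n\<close>. The choice
    need not be linear: by \<open>wd\<close>, \<phi> does not see it.\<close>
  define lift where "lift x = (SOME y. y \<in> E n \<and> del y = x - \<sigma> (del x))" for x
  have lift: "lift x \<in> E n" "del (lift x) = x - \<sigma> (del x)" if x: "x \<in> P" for x
  proof -
    have "x - \<sigma> (del x) \<in> P" "del (x - \<sigma> (del x)) = 0"
      using x \<sigma>P del_\<sigma> s.subspace_diff[OF P] by (auto simp: del.diff)
    then obtain y where "y \<in> E (n - 1 + 1)" "x - \<sigma> (del x) = del y"
      using exact unfolding P_def by blast
    then have "\<exists>y. y \<in> E n \<and> del y = x - \<sigma> (del x)"
      by (intro exI[of _ y]) simp
    then have "lift x \<in> E n \<and> del (lift x) = x - \<sigma> (del x)" unfolding lift_def by (rule someI_ex)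
    then show "lift x \<in> E n" "del (lift x) = x - \<sigma> (del x)" by auto
  qed
  have "k_linear_on P s (*) (\<lambda>x. \<phi> (lift x))"
    unfolding k_linear_on_def
  proof (intro conjI ballI allI)
    fix x y assume xy: "x \<in> P" "y \<in> P"
    then have "x + y \<in> P" using P by (simp add: s.subspace_add)
    then have "\<phi> (lift (x + y)) = \<phi> (lift x + lift y)"
      using xy by (intro wd) (simp_all add: lift del.add \<sigma>_add s.subspace_add[OF E(1)])
    then show "\<phi> (lift (x + y)) = \<phi> (lift x) + \<phi> (lift y)" by (simp add: \<phi>.add)
  next
    fix r x assume x: "x \<in> P"
    then have "s r x \<in> P" using P by (simp add: s.subspace_scale)
    then have "\<phi> (lift (s r x)) = \<phi> (s r (lift x))"
      using x by (intro wd)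
        (simp_all add: lift del.scale \<sigma>_scale s.subspace_scale[OF E(1)] s.scale_right_diff_distrib)
    then show "\<phi> (lift (s r x)) = r * \<phi> (lift x)" by (simp add: \<phi>.scale)
  qed
  moreover have "\<phi> x = \<phi> (lift (del x))" if x: "x \<in> E n" for x
  proof -
    have del_x: "del x \<in> P" using E(2)[OF x] by (simp add: P_def)
    \<comment> \<open>This says \<sigma> 0 = 0. Since \<open>del (del x) = 0\<close>, the correction
      by \<sigma> disappears from \<open>lift (del x)\<close>.\<close>
    have "\<sigma> (s 0 (del 0)) = s 0 (\<sigma> (del 0))" by (rule \<sigma>_scale[OF s.subspace_0[OF P]])
    then have "del (lift (del x)) = del x" using lift[OF del_x] by (simp add: del_del)
    then show ?thesis using wd[OF x lift(1)[OF del_x]] by simp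
  qed
  ultimately show ?thesis unfolding P_def by blast
qed

section \<open>The mapping cone of a quasi-isomorphism and its cocycles\<close>

lemma module_prod:
  assumes "module s" "module t"
  shows "module (\<lambda>r (x, y). (s r x, t r y))"
proof -
  interpret s: module s by fact
  interpret t: module t by fact
  show ?thesis
    by standard (auto simp: s.scale_right_distrib t.scale_right_distrib
        s.scale_left_distrib t.scale_left_distrib)
qed

text \<open>Freeness enters only as a family of finitely supported, jointly injective coordinates.
  They belong to a basis of the whole module; the grades take part in the splitting merely as
  submodules.\<close>

lemma (in dg_coalg) coordinates:
  assumes "k_free C"
  obtains \<pi> :: "'a \<Rightarrow> 'a \<Rightarrow> 'k" where "\<And>i. module_hom s (*) (\<pi> i)"
    and "\<And>x. finite {i. \<pi> i x \<noteq> 0}" and "\<And>x. (\<And>i. \<pi> i x = 0) \<Longrightarrow> x = 0"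
proof -
  obtain B where B: "independent B" "span B = UNIV"
    using assms total_UNIV by (auto simp: k_free_def)
  show thesis
  proof (rule that[of "\<lambda>i x. representation B x i"])
    show "module_hom s (*) (\<lambda>x. representation B x i)" for i
      using module_axioms module_mult B
      by (simp add: module_hom_iff representation_add representation_scale)
    show "finite {i. representation B x i \<noteq> 0}" for x by (rule finite_representation)
    show "x = 0" if "\<And>i. representation B x i = 0" for x
      using sum_nonzero_representation_eq[OF B(1), of x] B(2) that by simp
  qed
qed

locale coalg_quasi_iso = C: dg_coalg C + D: dg_coalg D
  for C :: "('k::principal_ideal_domain, 'c::ab_group_add) dg_coalgebra"
    and D :: "('k, 'd::ab_group_add) dg_coalgebra" +
  fixes f :: "'c \<Rightarrow> 'd"
  assumes f: "quasi_iso 0 C D f" and C_free: "k_free C" and D_free: "k_free D"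
begin

lemma dg_map_f: "dg_map 0 C D f"
  using f by (simp add: quasi_iso_def)

lemma f_hom: "module_hom C.s D.s f"
  using dg_map_f C.total_UNIV C.module_axioms D.module_axioms
  by (simp add: dg_map_def k_linear_on_def module_hom_iff)

sublocale f: module_hom C.s D.s f
  by (rule f_hom)

sublocale dC: module_hom C.s C.s C.d
  by (rule C.module_hom_diff)

sublocale dD: module_hom D.s D.s D.d
  by (rule D.module_hom_diff)

lemma f_grade: "x \<in> C.G m \<Longrightarrow> f x \<in> D.G m"
  using dg_map_f by (force simp: dg_map_def)

lemma f_diff: "D.d (f x) = f (C.d x)"
  using dg_map_f C.total_UNIV by (simp add: dg_map_def sgn_pow_def)

lemma
  f_inj: "x \<in> cycles C m \<Longrightarrow> f x \<in> boundaries D m \<Longrightarrow> x \<in> boundaries C m" and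
  f_surj: "z \<in> cycles D m \<Longrightarrow> \<exists>x\<in>cycles C m. z - f x \<in> boundaries D m"
  using f quasi_iso_iff[OF C.dg_module D.dg_module dg_map_f] by auto

text \<open>The cone has \<open>C.G (k - 1)\<close> and \<open>D.G k\<close> in degree
  \<open>k\<close>. The extension theorem writes \<phi> as \<psi> after the cone differential, with
  \<psi> on degree \<open>n - 1\<close>; restricted to the factors of degrees \<open>n - 2\<close>
  and \<open>n - 1\<close>, \<psi> gives \<gamma> and \<beta>, of dual degrees \<open>2 - n\<close>
  and \<open>1 - n\<close>. The minus sign before \<gamma> is that of
  \<open>- C.d x\<close>.\<close>

lemma cone_cocycle:
  fixes \<phi> :: "'c \<times> 'd \<Rightarrow> 'k"
  assumes \<phi>: "module_hom (\<lambda>r (x, y). (C.s r x, D.s r y)) (*) \<phi>"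
    and cocycle: "\<And>x y. x \<in> C.G n \<Longrightarrow> y \<in> D.G (n + 1) \<Longrightarrow> \<phi> (- C.d x, f x + D.d y) = 0"
  shows "\<exists>\<gamma>\<in>C.H (2 - n). \<exists>\<beta>\<in>D.H (1 - n).
    \<forall>x\<in>C.G (n - 1). \<forall>y\<in>D.G n. \<phi> (x, y) = \<beta> (f x + D.d y) - \<gamma> (C.d x)"
proof -
  let ?s = "\<lambda>r (x, y). (C.s r x, D.s r y)"
  let ?d = "\<lambda>(x, y). (- C.d x, f x + D.d y)"
  define E where "E k = C.G (k - 1) \<times> D.G k" for k
  obtain \<pi>C :: "'c \<Rightarrow> 'c \<Rightarrow> 'k" where \<pi>C: "\<And>i. module_hom C.s (*) (\<pi>C i)"
    "\<And>x. finite {i. \<pi>C i x \<noteq> 0}" "\<And>x. (\<And>i. \<pi>C i x = 0) \<Longrightarrow> x = 0"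
    using C.coordinates[OF C_free] by blast
  obtain \<pi>D :: "'d \<Rightarrow> 'd \<Rightarrow> 'k" where \<pi>D: "\<And>i. module_hom D.s (*) (\<pi>D i)"
    "\<And>x. finite {i. \<pi>D i x \<noteq> 0}" "\<And>x. (\<And>i. \<pi>D i x = 0) \<Longrightarrow> x = 0"
    using D.coordinates[OF D_free] by blast
  define \<pi> where "\<pi> i = (\<lambda>(x, y). case i of Inl j \<Rightarrow> \<pi>C j x | Inr j \<Rightarrow> \<pi>D j y)" for i
  have s: "module ?s"
    using \<phi> by (simp add: module_hom_def)
  have "\<exists>\<psi>. k_linear_on (E (n - 1)) ?s (*) \<psi> \<and> (\<forall>x\<in>E n. \<phi> x = \<psi> (?d x))"
  proof (rule extend_cocycle)
    show "module_hom ?s (*) (\<pi> i)" for i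
      using s module_mult \<pi>C(1) \<pi>D(1)
      by (cases i) (auto simp: \<pi>_def module_hom_iff)
    show "finite {i. \<pi> i x \<noteq> 0}" for x
    proof (rule finite_subset)
      show "{i. \<pi> i x \<noteq> 0} \<subseteq> Inl ` {i. \<pi>C i (fst x) \<noteq> 0} \<union> Inr ` {i. \<pi>D i (snd x) \<noteq> 0}"
        by (auto simp: \<pi>_def case_prod_unfold image_iff split: sum.splits) (metis obj_sumE)
      show "finite (Inl ` {i. \<pi>C i (fst x) \<noteq> 0} \<union> Inr ` {i. \<pi>D i (snd x) \<noteq> 0})"
        using \<pi>C(2) \<pi>D(2) by simp
    qed
    show "x = 0" if "\<And>i. \<pi> i x = 0" for x
      using \<pi>C(3)[of "fst x"] \<pi>D(3)[of "snd x"] that[of "Inl i" for i] that[of "Inr i" for i]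
      by (auto simp: \<pi>_def prod_eq_iff case_prod_unfold)
    show "module_hom ?s ?s ?d"
      using s by (auto simp: module_hom_iff dC.add dD.add f.add dC.scale dD.scale f.scale
          D.scale_right_distrib)
    show "?d (?d x) = 0" for x
      by (auto simp: dC.neg f.neg dD.add f_diff zero_prod_def split: prod.splits)
    show "module.subspace ?s (E k)" for k
      unfolding E_def using C.subspace_grade[of "k - 1"] D.subspace_grade[of k]
      by (intro module.subspaceI[OF s])
        (auto simp: zero_prod_def C.subspace_0 D.subspace_0 C.subspace_add D.subspace_add
          C.subspace_scale D.subspace_scale)
    show "?d x \<in> E (k - 1)" if x: "x \<in> E k" for k x
    proof -
      obtain u v where uv: "x = (u, v)" "u \<in> C.G (k - 1)" "v \<in> D.G k"
        using x by (auto simp: E_def)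
      then show ?thesis
        using C.subspace_neg[OF C.subspace_grade C.diff_grade[OF uv(2)]]
          D.subspace_add[OF D.subspace_grade f_grade[OF uv(2)] D.diff_grade[OF uv(3)]]
        by (simp add: E_def)
    qed
    \<comment> \<open>Acyclicity of the cone. From \<open>f u = D.d (- v)\<close>, injectivity on
      homology gives \<open>u = C.d u'\<close>. The cycle \<open>f u' + v\<close> need not bound,
      but surjectivity provides a cycle \<open>w\<close> such that \<open>f u' + v - f w\<close>
      does; replacing \<open>u'\<close> by \<open>u' - w\<close> leaves its boundary
      unchanged.\<close>
    show "\<exists>y\<in>E (k + 1). x = ?d y" if x: "x \<in> E k" "?d x = 0" for k x
    proof -
      obtain u v where uv: "x = (u, v)" "u \<in> C.G (k - 1)" "v \<in> D.G k"
        using x by (auto simp: E_def)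
      have du: "C.d u = 0" and fu: "f u + D.d v = 0" using x uv by (auto simp: zero_prod_def)
      have "f u = D.d (- v)" using fu by (simp add: dD.neg eq_neg_iff_add_eq_0)
      moreover have "- v \<in> D.G (k - 1 + 1)" using uv by (simp add: D.subspace_neg[OF D.subspace_grade])
      ultimately have "f u \<in> boundaries D (k - 1)" unfolding boundaries_def by blast
      moreover have "u \<in> cycles C (k - 1)" using du uv by (simp add: cycles_def)
      ultimately have "u \<in> boundaries C (k - 1)" by (rule f_inj[rotated])
      then obtain u' where u': "u' \<in> C.G k" "u = C.d u'" by (auto simp: boundaries_def)
      have "f u' + v \<in> D.G k"
        by (rule D.subspace_add[OF D.subspace_grade f_grade[OF u'(1)] uv(3)])
      then have "f u' + v \<in> cycles D k" using fu by (simp add: cycles_def dD.add f_diff u'(2))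
      then obtain w where w: "w \<in> cycles C k" "f u' + v - f w \<in> boundaries D k"
        using f_surj by blast
      then obtain v' where v': "v' \<in> D.G (k + 1)" "f u' + v - f w = D.d v'"
        unfolding boundaries_def by blast
      have "w - u' \<in> C.G k"
        using w u' C.subspace_diff[OF C.subspace_grade] by (simp add: cycles_def)
      then have "(w - u', v') \<in> E (k + 1)" using v' by (simp add: E_def)
      moreover have "x = ?d (w - u', v')"
        using w u' v'(2) uv by (simp add: cycles_def dC.diff f.diff algebra_simps)
      ultimately show ?thesis by blast
    qed
    show "module_hom ?s (*) \<phi>" by fact
    show "\<phi> (?d x) = 0" if "x \<in> E (n + 1)" for x
      using that cocycle by (auto simp: E_def)
  qed
  then obtain \<psi> where lin: "k_linear_on (E (n - 1)) ?s (*) \<psi>"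
    and \<psi>: "\<And>x y. x \<in> C.G (n - 1) \<Longrightarrow> y \<in> D.G n \<Longrightarrow> \<phi> (x, y) = \<psi> (- C.d x, f x + D.d y)"
    by (auto simp: E_def)
  have in_E: "(x, 0) \<in> E (n - 1)" "(0, y) \<in> E (n - 1)" "(x, y) \<in> E (n - 1)"
    if "x \<in> C.G (n - 2)" "y \<in> D.G (n - 1)" for x y
    using that C.subspace_0[OF C.subspace_grade] D.subspace_0[OF D.subspace_grade]
    by (auto simp: E_def)
  have 0: "0 \<in> C.G (n - 2)" "0 \<in> D.G (n - 1)"
    using C.subspace_0[OF C.subspace_grade] D.subspace_0[OF D.subspace_grade] by auto
  have \<psi>_add: "\<psi> (x + x', y + y') = \<psi> (x, y) + \<psi> (x', y')"
    if "x \<in> C.G (n - 2)" "y \<in> D.G (n - 1)" "x' \<in> C.G (n - 2)" "y' \<in> D.G (n - 1)" for x y x' y'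
    using lin in_E that unfolding k_linear_on_def by (metis add_Pair)
  have \<psi>_scale: "\<psi> (C.s r x, D.s r y) = r * \<psi> (x, y)"
    if "x \<in> C.G (n - 2)" "y \<in> D.G (n - 1)" for r x y
    using lin in_E(3)[OF that] unfolding k_linear_on_def by fastforce
  have \<psi>_0: "\<psi> (0, 0) = 0" using \<psi>_scale[OF 0, of 0] by simp
  \<comment> \<open>\<psi> is linear only on one degree of the cone. Composing with the projections
    to components makes \<gamma> and \<beta> linear on all of \<open>C\<close> and \<open>D\<close>
    and zero in the other degrees.\<close>
  define \<gamma> where "\<gamma> x = \<psi> (component C.G (n - 2) x, 0)" for x
  define \<beta> where "\<beta> y = \<psi> (0, component D.G (n - 1) y)" for y
  have "\<gamma> \<in> C.H (2 - n)"
  proof (rule C.dual_gradeI)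
    have "\<gamma> (x + y) = \<gamma> x + \<gamma> y" for x y
      using \<psi>_add[OF C.component_grade 0(2) C.component_grade 0(2), of x y]
      by (simp add: \<gamma>_def C.component_add)
    moreover have "\<gamma> (C.s r x) = r * \<gamma> x" for r x
      using \<psi>_scale[OF C.component_grade 0(2), of r x] by (simp add: \<gamma>_def C.component_scale)
    ultimately show "module_hom C.s (*) \<gamma>"
      using C.module_axioms module_mult by (simp add: module_hom_iff)
    show "\<gamma> x = 0" if "x \<in> C.G i" "i + (2 - n) \<noteq> 0" for i x
      using that by (simp add: \<gamma>_def C.component_homogeneous[OF that(1)] \<psi>_0)
  qed
  moreover have "\<beta> \<in> D.H (1 - n)"
  proof (rule D.dual_gradeI)
    have "\<beta> (x + y) = \<beta> x + \<beta> y" for x y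
      using \<psi>_add[OF 0(1) D.component_grade 0(1) D.component_grade, of x y]
      by (simp add: \<beta>_def D.component_add)
    moreover have "\<beta> (D.s r x) = r * \<beta> x" for r x
      using \<psi>_scale[OF 0(1) D.component_grade, of r x] by (simp add: \<beta>_def D.component_scale)
    ultimately show "module_hom D.s (*) \<beta>"
      using D.module_axioms module_mult by (simp add: module_hom_iff)
    show "\<beta> x = 0" if "x \<in> D.G i" "i + (1 - n) \<noteq> 0" for i x
      using that by (simp add: \<beta>_def D.component_homogeneous[OF that(1)] \<psi>_0)
  qed
  moreover have "\<phi> (x, y) = \<beta> (f x + D.d y) - \<gamma> (C.d x)" if x: "x \<in> C.G (n - 1)" and y: "y \<in> D.G n" for x y
  proof -
    have dx: "C.d x \<in> C.G (n - 2)" using C.diff_grade[OF x] by simp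
    have fy: "f x + D.d y \<in> D.G (n - 1)"
      by (rule D.subspace_add[OF D.subspace_grade f_grade[OF x] D.diff_grade[OF y]])
    have "\<psi> (- C.d x, f x + D.d y) = \<psi> (- C.d x, 0) + \<psi> (0, f x + D.d y)"
      using \<psi>_add[OF C.subspace_neg[OF C.subspace_grade dx] 0(2) 0(1) fy] by simp
    moreover have "\<psi> (- C.d x, 0) = - \<psi> (C.d x, 0)"
      using \<psi>_scale[OF dx 0(2), of "- 1"] by simp
    ultimately show ?thesis
      using \<psi>[OF x y] by (simp add: \<beta>_def \<gamma>_def C.component_homogeneous[OF dx]
          D.component_homogeneous[OF fy])
  qed
  ultimately show ?thesis by blast
qed

text \<open>Injectivity on homology of pullback along \<open>f\<close>. By \<open>eq\<close> and
  \<open>cocycle\<close> the pair (\<gamma>, \<beta>) vanishes on boundaries of the cone;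
  \<open>cone_cocycle\<close> at \<open>n = - m\<close> makes it a coboundary, and setting
  \<open>x = 0\<close> leaves \<beta> y = \<beta>' (d y).\<close>

lemma dual_inj:
  assumes \<beta>: "\<beta> \<in> D.H m" and cocycle: "\<And>y. \<beta> (D.d y) = 0"
    and \<gamma>: "\<gamma> \<in> C.H (m + 1)" and eq: "\<And>x. \<beta> (f x) = \<gamma> (C.d x)"
  shows "\<exists>\<beta>'\<in>D.H (m + 1). \<forall>y. \<beta> y = \<beta>' (D.d y)"
proof -
  let ?\<phi> = "\<lambda>(x, y). \<gamma> x + \<beta> y"
  note lin = C.dual_add[OF \<gamma>] D.dual_add[OF \<beta>] C.dual_scale[OF \<gamma>] D.dual_scale[OF \<beta>]
  have "\<exists>\<gamma>'\<in>C.H (2 - (- m)). \<exists>\<beta>'\<in>D.H (1 - (- m)).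
    \<forall>x\<in>C.G (- m - 1). \<forall>y\<in>D.G (- m). ?\<phi> (x, y) = \<beta>' (f x + D.d y) - \<gamma>' (C.d x)"
  proof (rule cone_cocycle)
    show "module_hom (\<lambda>r (x, y). (C.s r x, D.s r y)) (*) ?\<phi>"
      using module_prod[OF C.module_axioms D.module_axioms] module_mult
      by (auto simp: module_hom_iff lin algebra_simps)
    show "?\<phi> (- C.d x, f x + D.d y) = 0" for x y
      using module_hom.neg[OF C.dual_hom[OF \<gamma>]] by (simp add: lin eq cocycle)
  qed
  then obtain \<gamma>' \<beta>' where \<gamma>': "\<gamma>' \<in> C.H (2 + m)" and \<beta>': "\<beta>' \<in> D.H (m + 1)"
    and \<phi>: "\<And>x y. x \<in> C.G (- m - 1) \<Longrightarrow> y \<in> D.G (- m) \<Longrightarrow>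
      \<gamma> x + \<beta> y = \<beta>' (f x + D.d y) - \<gamma>' (C.d x)"
    by (auto simp: add.commute)
  have hom: "module_hom D.s (*) (\<lambda>y. \<beta>' (D.d y))"
    using D.dual_hom[OF D.comp_diff_dual_grade[OF \<beta>']] .
  have "\<beta> y = \<beta>' (D.d y)" for y
  proof (rule D.dual_eqI[OF D.dual_hom[OF \<beta>] hom])
    fix i y assume y: "y \<in> D.G i"
    show "\<beta> y = \<beta>' (D.d y)"
    proof (cases "i = - m")
      case True
      then show ?thesis
        using \<phi>[OF C.subspace_0[OF C.subspace_grade], of y] y
        by (simp add: C.dual_zero[OF \<gamma>] C.dual_zero[OF \<gamma>'] dC.zero f.zero)
    next
      case False
      then show ?thesis
        using D.dual_vanish[OF \<beta> y] D.dual_vanish[OF D.comp_diff_dual_grade[OF \<beta>'] y] by simp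
    qed
  qed
  then show ?thesis using \<beta>' by blast
qed

lemma comp_f_dual: "\<beta> \<in> D.H m \<Longrightarrow> (\<lambda>x. \<beta> (f x)) \<in> C.H m"
  using module_hom_compI[OF f_hom D.dual_hom] D.dual_vanish[OF _ f_grade]
  by (intro C.dual_gradeI) blast+

text \<open>Surjectivity on homology of pullback along \<open>f\<close>, from
  \<open>cone_cocycle\<close> for the pair (\<alpha>, 0). The shift \<open>n = 1 - m\<close> puts
  \<alpha> on the factor \<open>C.G (n - 1)\<close>. Setting \<open>x = 0\<close> shows that \<beta>
  is a cocycle, setting \<open>y = 0\<close> that it pulls back to \<alpha> up to a
  coboundary.\<close>

lemma dual_surj:
  assumes \<alpha>: "\<alpha> \<in> C.H m" and cocycle: "\<And>x. \<alpha> (C.d x) = 0"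
  shows "\<exists>\<beta>\<in>D.H m. (\<forall>y. \<beta> (D.d y) = 0) \<and> (\<exists>\<gamma>\<in>C.H (m + 1). \<forall>x. \<alpha> x = \<beta> (f x) - \<gamma> (C.d x))"
proof -
  let ?\<phi> = "\<lambda>(x, y). \<alpha> x"
  have "\<exists>\<gamma>\<in>C.H (2 - (1 - m)). \<exists>\<beta>\<in>D.H (1 - (1 - m)).
    \<forall>x\<in>C.G (1 - m - 1). \<forall>y\<in>D.G (1 - m). ?\<phi> (x, y) = \<beta> (f x + D.d y) - \<gamma> (C.d x)"
  proof (rule cone_cocycle)
    show "module_hom (\<lambda>r (x, y). (C.s r x, D.s r y)) (*) ?\<phi>"
      using module_prod[OF C.module_axioms D.module_axioms] module_mult
      by (auto simp: module_hom_iff C.dual_add[OF \<alpha>] C.dual_scale[OF \<alpha>])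
    show "?\<phi> (- C.d x, f x + D.d y) = 0" for x y
      using module_hom.neg[OF C.dual_hom[OF \<alpha>]] by (simp add: cocycle)
  qed
  then obtain \<gamma> \<beta> where \<gamma>: "\<gamma> \<in> C.H (m + 1)" and \<beta>: "\<beta> \<in> D.H m"
    and \<phi>: "\<And>x y. x \<in> C.G (- m) \<Longrightarrow> y \<in> D.G (1 - m) \<Longrightarrow> \<alpha> x = \<beta> (f x + D.d y) - \<gamma> (C.d x)"
    by (auto simp: add.commute)
  have "\<beta> (D.d y) = 0" for y
  proof (rule D.dual_eqI[OF D.dual_hom[OF D.comp_diff_dual_grade[OF \<beta>]] D.module_hom_zero_fun])
    fix i y assume y: "y \<in> D.G i"
    show "\<beta> (D.d y) = 0"
    proof (cases "i = 1 - m")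
      case True
      then show ?thesis
        using \<phi>[OF C.subspace_0[OF C.subspace_grade], of y] y
        by (simp add: C.dual_zero[OF \<gamma>] C.dual_zero[OF \<alpha>] dC.zero f.zero)
    qed (use D.dual_vanish[OF D.comp_diff_dual_grade[OF \<beta>] y] in simp)
  qed
  moreover have "\<alpha> x = \<beta> (f x) - \<gamma> (C.d x)" for x
  proof (rule C.dual_eqI[OF C.dual_hom[OF \<alpha>]])
    show "module_hom C.s (*) (\<lambda>x. \<beta> (f x) - \<gamma> (C.d x))"
      by (rule module_pair.module_hom_sub[OF C.module_pair_mult C.dual_hom[OF comp_f_dual[OF \<beta>]]
            C.dual_hom[OF C.comp_diff_dual_grade[OF \<gamma>]]])
    fix i x assume x: "x \<in> C.G i"
    show "\<alpha> x = \<beta> (f x) - \<gamma> (C.d x)"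
    proof (cases "i = - m")
      case True
      then show ?thesis
        using \<phi>[OF _ D.subspace_0[OF D.subspace_grade], of x] x by (simp add: dD.zero)
    next
      case False
      then show ?thesis
        using C.dual_vanish[OF \<alpha> x] C.dual_vanish[OF comp_f_dual[OF \<beta>] x]
          C.dual_vanish[OF C.comp_diff_dual_grade[OF \<gamma>] x] by simp
    qed
  qed
  ultimately show ?thesis using \<beta> \<gamma> by blast
qed

end

section \<open>Homology of the dual and comparison of the two cap products\<close>

context dg_coalg
begin

lemma cycles_dual: "\<phi> \<in> cycles (dual C) m \<longleftrightarrow> \<phi> \<in> H m \<and> (\<forall>x. \<phi> (d x) = 0)"
proof -
  have "(sgn_pow m * a = 0) \<longleftrightarrow> a = 0" for a :: 'k by (simp add: sgn_pow_def)
  then show ?thesis by (auto simp: cycles_def fun_eq_iff diff_dual_homogeneous)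
qed

text \<open>The sign in the dual differential is a unit and is absorbed into the witness, so
  coboundaries become plain composites with \<open>d\<close>, as delivered by the cone
  argument.\<close>

lemma boundaries_dual:
  "\<phi> \<in> boundaries (dual C) m \<longleftrightarrow> (\<exists>\<psi>\<in>H (m + 1). \<forall>x. \<phi> x = \<psi> (d x))"
proof
  assume "\<phi> \<in> boundaries (dual C) m"
  then obtain \<psi> where \<psi>: "\<psi> \<in> H (m + 1)" "\<phi> = diff (dual C) \<psi>" by (auto simp: boundaries_def)
  show "\<exists>\<psi>\<in>H (m + 1). \<forall>x. \<phi> x = \<psi> (d x)"
  proof (rule bexI)
    show "\<forall>x. \<phi> x = (s_dual (- sgn_pow (m + 1)) \<psi>) (d x)"
      by (simp add: \<psi>(2) diff_dual_homogeneous[OF \<psi>(1)])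
    show "s_dual (- sgn_pow (m + 1)) \<psi> \<in> H (m + 1)"
      by (rule dual.subspace_scale[OF subspace_dual_grade \<psi>(1)])
  qed
next
  assume "\<exists>\<psi>\<in>H (m + 1). \<forall>x. \<phi> x = \<psi> (d x)"
  then obtain \<psi> where \<psi>: "\<psi> \<in> H (m + 1)" "\<And>x. \<phi> x = \<psi> (d x)" by blast
  have \<psi>': "s_dual (- sgn_pow (m + 1)) \<psi> \<in> H (m + 1)"
    by (rule dual.subspace_scale[OF subspace_dual_grade \<psi>(1)])
  have "sgn_pow (m + 1) * (sgn_pow (m + 1) * a) = a" for a :: 'k by (simp add: sgn_pow_def)
  then have "\<phi> = diff (dual C) (s_dual (- sgn_pow (m + 1)) \<psi>)"
    unfolding fun_eq_iff diff_dual_homogeneous[OF \<psi>'] by (simp add: \<psi>(2))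
  then show "\<phi> \<in> boundaries (dual C) m"
    using \<psi>' unfolding boundaries_def by simp
qed

text \<open>For a cocycle \<phi> the first term of the Leibniz rule drops out, leaving a boundary.
  This is what permits replacing \<open>d\<close> by the homologous cycle
  \<open>f c\<close>.\<close>

lemma cap_boundary:
  assumes e: "e \<in> G (n + 1)" and \<phi>: "\<phi> \<in> cycles (dual C) m"
  shows "cap C (d e) \<phi> \<in> boundaries C (m + n)"
proof -
  have \<phi>': "\<phi> \<in> H m" "\<And>x. \<phi> (d x) = 0" using \<phi> by (auto simp: cycles_dual)
  have "contract (\<lambda>x. \<phi> (d x)) e = 0" by (simp add: contract_def \<phi>' lin_ext_def)
  then have contr: "contract \<phi> (d e) = d (s (sgn_pow m) (contract \<phi> e))"
    using contract_leibniz[OF \<phi>'(1), of e] by (simp add: diff_scale)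
  have "d e \<in> G n" using diff_grade[OF e] by simp
  then have "cap C (d e) \<phi> = d (s (sgn_pow (n * m) * sgn_pow m) (contract \<phi> e))"
    by (simp add: cap_homogeneous[OF _ \<phi>'(1)] contr diff_scale)
  moreover have "s (sgn_pow (n * m) * sgn_pow m) (contract \<phi> e) \<in> G (m + n + 1)"
    using subspace_scale[OF subspace_grade contract_grade[OF e \<phi>'(1)]] by (simp add: ac_simps)
  ultimately show ?thesis unfolding boundaries_def by (rule image_eqI)
qed

end

text \<open>Applying \<open>f\<close> to both factors of a representative for \<open>c\<close> gives
  an admissible representative for \<open>f c\<close>, on which the contractions agree. The signs
  agree because \<open>f\<close> preserves degrees.\<close>

lemma (in coalg_quasi_iso) cap_natural:
  assumes hom: "dg_coalgebra_hom C D f" and c: "c \<in> C.G n" and \<beta>: "\<beta> \<in> D.H m"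
  shows "f (cap C c (\<lambda>x. \<beta> (f x))) = cap D (f c) \<beta>"
proof -
  let ?p = "comult_rep C c"
  have "lin_ext fscale (\<lambda>(x, y). gen (f x, f y)) ?p \<in> comult D (f c)"
    using hom C.comult_rep unfolding dg_coalgebra_hom_def by blast
  then have "D.contract \<beta> (f c) =
      lin_ext D.s (\<lambda>(x, y). D.s (\<beta> x) y) (lin_ext fscale (\<lambda>(x, y). gen (f x, f y)) ?p)"
    by (rule D.contract_eq[OF D.dual_hom[OF \<beta>]])
  also have "\<dots> = f (C.contract (\<lambda>x. \<beta> (f x)) c)"
    by (simp add: C.contract_def lin_ext_hom[OF f_hom] lin_ext_lin_ext[OF D.module_axioms]
        lin_ext_gen[OF D.module_axioms] case_prod_unfold f.scale)
  finally show ?thesis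
    by (simp add: C.cap_homogeneous[OF c comp_f_dual[OF \<beta>]] D.cap_homogeneous[OF f_grade[OF c] \<beta>]
        f.scale)
qed

theorem proposition41:
  fixes C :: "('k::principal_ideal_domain, 'c::ab_group_add) dg_coalgebra"
    and D :: "('k, 'd::ab_group_add) dg_coalgebra"
    and f :: "'c \<Rightarrow> 'd" and n :: int and c :: 'c and d :: 'd
  assumes "is_dg_coalgebra C" and "is_dg_coalgebra D"
    and "k_free C" and "k_free D"
    and "dg_coalgebra_hom C D f" and "quasi_iso 0 C D f"
    and "c \<in> cycles C n" and "d \<in> cycles D n"
    and "homology_class D n d = homology_map D n f (homology_class C n c)"
  shows "dual_module_hom n C (cap C c) \<and> dual_module_hom n D (cap D d) \<and>
    (quasi_iso n (dual C) C (cap C c) \<longleftrightarrow> quasi_iso n (dual D) D (cap D d))"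
proof -
  interpret coalg_quasi_iso C D f
    using assms by (simp add: coalg_quasi_iso_def coalg_quasi_iso_axioms_def dg_coalg_def)
  interpret ZC: dg_mod C by (rule dg_mod.intro[OF C.dg_module])
  interpret ZD: dg_mod D by (rule dg_mod.intro[OF D.dg_module])
  interpret ZdC: dg_mod "dual C" by (rule dg_mod.intro[OF C.dg_module_dual])
  note c = assms(7) and d = assms(8)
  note f_cycles = dg_map_cycles[OF C.dg_module D.dg_module dg_map_f, simplified]
  note f_boundaries = dg_map_boundaries[OF C.dg_module D.dg_module dg_map_f, simplified]
  note capC = C.dg_map_cap[OF c] and capD = D.dg_map_cap[OF d]
  note C_iff = quasi_iso_iff[OF C.dg_module_dual C.dg_module capC]
    and C_cycles = dg_map_cycles[OF C.dg_module_dual C.dg_module capC]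
    and C_boundaries = dg_map_boundaries[OF C.dg_module_dual C.dg_module capC]
    and C_diff = dg_map_cycles_diff[OF C.dg_module_dual C.dg_module capC]
  note D_iff = quasi_iso_iff[OF D.dg_module_dual D.dg_module capD]
  let ?f = "\<lambda>\<beta> x. \<beta> (f x)"
  \<comment> \<open>Together, the next four facts express that pullback of forms along
    \<open>f\<close> is an isomorphism on homology.\<close>
  have dual_cycles: "?f \<beta> \<in> cycles (dual C) m" if "\<beta> \<in> cycles (dual D) m" for \<beta> m
    using that comp_f_dual by (auto simp: C.cycles_dual D.cycles_dual f_diff[symmetric])
  have dual_boundaries: "?f \<beta> \<in> boundaries (dual C) m" if "\<beta> \<in> boundaries (dual D) m" for \<beta> m
    using that comp_f_dual by (force simp: C.boundaries_dual D.boundaries_dual f_diff)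
  have dual_reflects: "\<beta> \<in> boundaries (dual D) m"
    if "\<beta> \<in> cycles (dual D) m" "?f \<beta> \<in> boundaries (dual C) m" for \<beta> m
    using that dual_inj by (auto simp: C.boundaries_dual D.boundaries_dual D.cycles_dual)
  have dual_lift: "\<exists>\<beta>\<in>cycles (dual D) m. \<alpha> - ?f \<beta> \<in> boundaries (dual C) m"
    if \<alpha>: "\<alpha> \<in> cycles (dual C) m" for \<alpha> m
  proof -
    obtain \<beta> \<gamma> where \<beta>: "\<beta> \<in> D.H m" "\<forall>y. \<beta> (D.d y) = 0"
      and \<gamma>: "\<gamma> \<in> C.H (m + 1)" "\<And>x. \<alpha> x = \<beta> (f x) - \<gamma> (C.d x)"
      using dual_surj[of \<alpha> m] \<alpha> by (auto simp: C.cycles_dual)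
    \<comment> \<open>The difference of \<alpha> and the pullback of \<beta> is minus \<gamma> after
      the differential, so the witness is the negative of \<gamma>.\<close>
    have "(\<lambda>x. - 1 * \<gamma> x) \<in> C.H (m + 1)"
      by (rule C.dual.subspace_scale[OF C.subspace_dual_grade \<gamma>(1)])
    then have "\<alpha> - ?f \<beta> \<in> boundaries (dual C) m"
      unfolding C.boundaries_dual using \<gamma>(2) by (intro bexI[of _ "\<lambda>x. - 1 * \<gamma> x"]) auto
    then show ?thesis using \<beta> by (auto simp: D.cycles_dual)
  qed
  have "(d, f c) \<in> homologous D n"
  proof -
    have "(d, d) \<in> homologous D n"
      using d D.subspace_0[OF ZD.subspace_boundaries] by (simp add: homologous_def)
    then have "d \<in> homology_map D n f (homology_class C n c)"
      using assms(9) by (auto simp: homology_class_def)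
    \<comment> \<open>\<open>homology_map\<close> is a union over all representatives of the class
      of \<open>c\<close>, so some \<open>x\<close> homologous to \<open>c\<close> appears first and
      has to be exchanged for \<open>c\<close>.\<close>
    then obtain x where x: "(c, x) \<in> homologous C n" "(f x, d) \<in> homologous D n"
      by (auto simp: homology_map_def homology_class_def)
    have "f c - f x \<in> boundaries D n"
      using f_boundaries[of "c - x" n] x(1) by (simp add: homologous_def f.diff)
    then have "(f c, f x) \<in> homologous D n"
      using x(1) f_cycles by (simp add: homologous_def)
    then show ?thesis
      using x(2) ZD.equiv_homologous[of n] by (meson equivE symE transE)
  qed
  then obtain e where e: "e \<in> D.G (n + 1)" "d - f c = D.d e"
    unfolding homologous_def boundaries_def by blast
  \<comment> \<open>Commutativity of the square up to boundaries: \<open>d\<close> is exchanged for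
    \<open>f c\<close> at the cost of the boundary \<open>D.d e\<close>, after which naturality is
    an exact equality.\<close>
  have compare: "cap D d \<beta> - f (cap C c (?f \<beta>)) \<in> boundaries D (m + n)"
    if \<beta>: "\<beta> \<in> cycles (dual D) m" for \<beta> m
  proof -
    have \<beta>H: "\<beta> \<in> D.H m" using \<beta> by (simp add: D.cycles_dual)
    have cG: "c \<in> C.G n" using c by (simp add: cycles_def)
    have "cap D d \<beta> - cap D (f c) \<beta> = cap D (D.d e) \<beta>"
      using module_hom.diff[OF D.cap_hom[OF D.dual.grade_subset_carrier[OF \<beta>H]], of d "f c"] e(2)
      by simp
    then show ?thesis
      using D.cap_boundary[OF e(1) \<beta>] cap_natural[OF assms(5) cG \<beta>H] by simp
  qed
  have bd_trans: "x - z \<in> boundaries D m" if "x - y \<in> boundaries D m" "y - z \<in> boundaries D m" for x y z m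
    using D.subspace_add[OF ZD.subspace_boundaries that] by simp
  have bd_iff: "x \<in> boundaries D m \<longleftrightarrow> y \<in> boundaries D m" if "x - y \<in> boundaries D m" for x y m
    using D.subspace_add[OF ZD.subspace_boundaries that, of y]
      D.subspace_diff[OF ZD.subspace_boundaries _ that, of x] by auto
  have "quasi_iso n (dual C) C (cap C c) \<longleftrightarrow> quasi_iso n (dual D) D (cap D d)"
  proof
    assume "quasi_iso n (dual C) C (cap C c)"
    then have inj: "\<And>m \<alpha>. \<alpha> \<in> cycles (dual C) m \<Longrightarrow> cap C c \<alpha> \<in> boundaries C (m + n) \<Longrightarrow>
        \<alpha> \<in> boundaries (dual C) m"
      and sur: "\<And>m x. x \<in> cycles C (m + n) \<Longrightarrow>
        \<exists>\<alpha>\<in>cycles (dual C) m. x - cap C c \<alpha> \<in> boundaries C (m + n)"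
      unfolding C_iff by blast+
    show "quasi_iso n (dual D) D (cap D d)"
      unfolding D_iff
    proof (intro allI conjI ballI impI)
      fix m \<beta> assume \<beta>: "\<beta> \<in> cycles (dual D) m" and bd: "cap D d \<beta> \<in> boundaries D (m + n)"
      have "f (cap C c (?f \<beta>)) \<in> boundaries D (m + n)" using bd_iff[OF compare[OF \<beta>]] bd by simp
      then have "cap C c (?f \<beta>) \<in> boundaries C (m + n)"
        by (rule f_inj[OF C_cycles[OF dual_cycles[OF \<beta>]]])
      then show "\<beta> \<in> boundaries (dual D) m"
        by (intro dual_reflects[OF \<beta>] inj[OF dual_cycles[OF \<beta>]])
    next
      \<comment> \<open>\<open>z\<close> is lifted backwards through the three legs in turn: through
        \<open>f\<close>, through \<open>cap C c\<close>, and through pullback of forms.\<close>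
      fix m z assume "z \<in> cycles D (m + n)"
      then obtain x where x: "x \<in> cycles C (m + n)" "z - f x \<in> boundaries D (m + n)"
        using f_surj by blast
      obtain \<alpha> where \<alpha>: "\<alpha> \<in> cycles (dual C) m" "x - cap C c \<alpha> \<in> boundaries C (m + n)"
        using sur[OF x(1)] by blast
      obtain \<beta> where \<beta>: "\<beta> \<in> cycles (dual D) m" "\<alpha> - ?f \<beta> \<in> boundaries (dual C) m"
        using dual_lift[OF \<alpha>(1)] by blast
      have "cap C c \<alpha> - cap C c (?f \<beta>) \<in> boundaries C (m + n)"
        using C_boundaries[OF \<beta>(2)] C_diff[OF \<alpha>(1) dual_cycles[OF \<beta>(1)]] by simp
      then have "x - cap C c (?f \<beta>) \<in> boundaries C (m + n)"
        using C.subspace_add[OF ZC.subspace_boundaries \<alpha>(2)] by fastforce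
      then have "f x - f (cap C c (?f \<beta>)) \<in> boundaries D (m + n)"
        using f_boundaries by (metis f.diff)
      moreover have "f (cap C c (?f \<beta>)) - cap D d \<beta> \<in> boundaries D (m + n)"
        using D.subspace_neg[OF ZD.subspace_boundaries compare[OF \<beta>(1)]] by simp
      ultimately have "z - cap D d \<beta> \<in> boundaries D (m + n)"
        using bd_trans x(2) by blast
      then show "\<exists>\<beta>\<in>cycles (dual D) m. z - cap D d \<beta> \<in> boundaries D (m + n)" using \<beta> by blast
    qed
  next
    assume "quasi_iso n (dual D) D (cap D d)"
    then have inj: "\<And>m \<beta>. \<beta> \<in> cycles (dual D) m \<Longrightarrow> cap D d \<beta> \<in> boundaries D (m + n) \<Longrightarrow>
        \<beta> \<in> boundaries (dual D) m"
      and sur: "\<And>m z. z \<in> cycles D (m + n) \<Longrightarrow>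
        \<exists>\<beta>\<in>cycles (dual D) m. z - cap D d \<beta> \<in> boundaries D (m + n)"
      unfolding D_iff by blast+
    show "quasi_iso n (dual C) C (cap C c)"
      unfolding C_iff
    proof (intro allI conjI ballI impI)
      fix m \<alpha> assume \<alpha>: "\<alpha> \<in> cycles (dual C) m" and bd: "cap C c \<alpha> \<in> boundaries C (m + n)"
      \<comment> \<open>\<open>compare\<close> speaks only of forms pulled back from
        \<open>D\<close>, so \<alpha> is first replaced by a cohomologous pullback; the conclusion
        is carried back at the end.\<close>
      obtain \<beta> where \<beta>: "\<beta> \<in> cycles (dual D) m" "\<alpha> - ?f \<beta> \<in> boundaries (dual C) m"
        using dual_lift[OF \<alpha>] by blast
      have "cap C c \<alpha> - cap C c (?f \<beta>) \<in> boundaries C (m + n)"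
        using C_boundaries[OF \<beta>(2)] C_diff[OF \<alpha> dual_cycles[OF \<beta>(1)]] by simp
      then have "cap C c (?f \<beta>) \<in> boundaries C (m + n)"
        using C.subspace_diff[OF ZC.subspace_boundaries bd] by fastforce
      then have "f (cap C c (?f \<beta>)) \<in> boundaries D (m + n)" by (rule f_boundaries)
      then have "cap D d \<beta> \<in> boundaries D (m + n)" using bd_iff[OF compare[OF \<beta>(1)]] by simp
      then have "?f \<beta> \<in> boundaries (dual C) m" by (intro dual_boundaries inj[OF \<beta>(1)])
      then have "\<alpha> - ?f \<beta> + ?f \<beta> \<in> boundaries (dual C) m"
        by (rule ZdC.subspace_add[OF ZdC.subspace_boundaries \<beta>(2)])
      then show "\<alpha> \<in> boundaries (dual C) m" by simp
    next
      fix m x assume x: "x \<in> cycles C (m + n)"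
      \<comment> \<open>The preimage is found in \<open>D\<close> for \<open>f x\<close>. Its
        pullback serves for \<open>x\<close> because \<open>f\<close> is injective on homology,
        applied to the cycle \<open>x - cap C c (?f \<beta>)\<close>.\<close>
      obtain \<beta> where \<beta>: "\<beta> \<in> cycles (dual D) m" "f x - cap D d \<beta> \<in> boundaries D (m + n)"
        using sur[OF f_cycles[OF x]] by blast
      have cyc: "cap C c (?f \<beta>) \<in> cycles C (m + n)" by (rule C_cycles[OF dual_cycles[OF \<beta>(1)]])
      have "f (x - cap C c (?f \<beta>)) \<in> boundaries D (m + n)"
        using bd_trans[OF \<beta>(2) compare[OF \<beta>(1)]] by (simp add: f.diff)
      then have "x - cap C c (?f \<beta>) \<in> boundaries C (m + n)"
        by (rule f_inj[OF C.subspace_diff[OF ZC.subspace_cycles x cyc]])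
      then show "\<exists>\<alpha>\<in>cycles (dual C) m. x - cap C c \<alpha> \<in> boundaries C (m + n)"
        using dual_cycles[OF \<beta>(1)] by blast
    qed
  qed
  then show ?thesis
    using C.dual_module_hom_cap[OF c] D.dual_module_hom_cap[OF d] by blast
qed

end
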